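(* Let $n\ge 2$, $\gamma>0$, $r\in(0,\infty)$, and let $Z_0$ be the zero cell of the isotropic Poisson hyperplane process $X$ in $\mathbb{R}^n$ with intensity $\gamma$ and distance exponent $r$. For every $k\in\mathbb{N}$, \[ \Gamma\left(\frac{n}{r}+1\right)^k \kappa_n^k\left(\frac{n\kappa_n r}{2\gamma c(n,r)}\right)^{\frac{kn}{r}} \leq \mathbb{E}[V_n(Z_0)^k] \leq \Gamma\left(\frac{kn}{r}+1\right)\kappa_n^k\left(\frac{n\kappa_n r}{2\gamma c(n,r)}\right)^{\frac{kn}{r}}. \] In particular, for $k=1$, \[ \mathbb{E}[V_n(Z_0)]=\Gamma\left(\frac{n}{r}+1\right)\kappa_n\left(\frac{n\kappa_n r}{2\gamma c(n,r)}\right)^{\frac{n}{r}}. \]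
   Context: $V_n$ denotes $n$-dimensional volume, $S^{n-1}$ the unit sphere of $\mathbb{R}^n$, $\mathcal{H}^{n-1}$ the $(n-1)$-dimensional Hausdorff measure, $\kappa_n=\pi^{n/2}/\Gamma(\frac n2+1)$ the volume of the unit ball of $\mathbb{R}^n$. For $u\in S^{n-1}$, $t\ge 0$ let $H(u,t)=\{x\in\mathbb{R}^n:\langle x,u\rangle=t\}$. $A(n,n-1)$ is the space of affine hyperplanes of $\mathbb{R}^n$ with its standard topology and Borel $\sigma$-algebra. The Poisson hyperplane process $X$ in $\mathbb{R}^n$ with intensity $\gamma>0$ and distance exponent $r>0$ is the Poisson point process on $A(n,n-1)$ whose intensity measure $\Theta(\cdot)=\mathbb{E}X(\cdot)$ is \[ \Theta(\cdot)=\frac{2\gamma}{n\kappa_n}\int_{S^{n-1}}\int_0^\infty \mathbf{1}\{H(u,t)\in\cdot\}\,t^{r-1}\,dt\,\mathcal{H}^{n-1}(du). \] The zero cell is $Z_0=\bigcap_{H\in X}H^-$, where $H^-$ is the (almost surely unique) closed half-space bounded by $H$ that contains the origin. Finally, for any unit vector $e\in S^{n-1}$, \[ c(n,r)=\int_{S^{n-1}}\langle e,u\rangle_+^r\,\mathcal{H}^{n-1}(du)=\pi^{\frac{n-1}{2}}\frac{\Gamma(\frac{r+1}{2})}{\Gamma(\frac{r+n}{2})}, \] which does not depend on $e$, where $x_+=\max\{x,0\}$. *)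

theory Defs
  imports "HOL-Probability.Probability"
begin

section \<open>Hausdorff measure\<close>

text \<open>The normalisation \<open>\<kappa>\<^sub>s (diam E / 2)\<^sup>s\<close> is the one for which the \<open>s\<close>-dimensional Hausdorff
  measure on an \<open>s\<close>-dimensional Euclidean space is Lebesgue measure. The test for emptiness
  matters only for \<open>s = 0\<close>, and boundedness of the covering sets is required because
  \<^const>\<open>diameter\<close> is meaningful for bounded sets only.\<close>

definition hausdorff_weight :: "nat \<Rightarrow> 'a::metric_space set \<Rightarrow> ennreal" where
  "hausdorff_weight s E =
     (if E = {} then 0 else ennreal (unit_ball_vol (real s) * (diameter E / 2) ^ s))"

definition hausdorff_pre :: "nat \<Rightarrow> real \<Rightarrow> 'a::metric_space set \<Rightarrow> ennreal" where
  "hausdorff_pre s \<delta> A =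
     (INF E\<in>{E :: nat \<Rightarrow> 'a set. A \<subseteq> (\<Union>i. E i) \<and> (\<forall>i. bounded (E i) \<and> diameter (E i) \<le> \<delta>)}.
        \<Sum>i. hausdorff_weight s (E i))"

definition hausdorff_outer :: "nat \<Rightarrow> 'a::metric_space set \<Rightarrow> ennreal" where
  "hausdorff_outer s A = (SUP \<delta>\<in>{0<..}. hausdorff_pre s \<delta> A)"

definition hausdorff_measure :: "nat \<Rightarrow> 'a::metric_space measure" where
  "hausdorff_measure s = measure_of UNIV (sets borel) (hausdorff_outer s)"

section \<open>The space of affine hyperplanes\<close>

definition hyperplane :: "'a::euclidean_space \<Rightarrow> real \<Rightarrow> 'a set" where
  "hyperplane u t = {x. x \<bullet> u = t}"

definition hyperplanes :: "'a::euclidean_space set set" where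
  "hyperplanes = {hyperplane u t | u t. u \<in> sphere 0 1}"

text \<open>The standard topology is the quotient topology for the two-to-one parametrisation
  \<open>(u, t) \<mapsto> H(u, t)\<close> by \<open>S\<^sup>n\<^sup>-\<^sup>1 \<times> \<real>\<close>; see the lemma \<open>quotient_map_hyperplane\<close> below.\<close>

definition hyperplane_topology :: "'a::euclidean_space set topology" where
  "hyperplane_topology = topology (\<lambda>U. U \<subseteq> hyperplanes \<and>
     openin (top_of_set (sphere 0 1 \<times> UNIV)) {p \<in> sphere 0 1 \<times> UNIV. case_prod hyperplane p \<in> U})"

definition hyperplane_borel :: "'a::euclidean_space set measure" where
  "hyperplane_borel = sigma hyperplanes {U. openin hyperplane_topology U}"

lemma openin_hyperplane_topology:
  "openin hyperplane_topology U \<longleftrightarrow> U \<subseteq> hyperplanes \<and>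
     openin (top_of_set (sphere 0 1 \<times> UNIV)) {p \<in> sphere 0 1 \<times> UNIV. case_prod hyperplane p \<in> U}"
proof -
  let ?S = "sphere (0::'a) 1 \<times> (UNIV :: real set)"
  let ?pre = "\<lambda>U. {p \<in> ?S. case_prod hyperplane p \<in> U}"
  have "istopology (\<lambda>U. U \<subseteq> hyperplanes \<and> openin (top_of_set ?S) (?pre U))"
    unfolding istopology_def
  proof (intro conjI allI impI)
    fix U V
    assume "U \<subseteq> hyperplanes \<and> openin (top_of_set ?S) (?pre U)"
       and "V \<subseteq> hyperplanes \<and> openin (top_of_set ?S) (?pre V)"
    moreover have "?pre (U \<inter> V) = ?pre U \<inter> ?pre V" by blast
    ultimately show "U \<inter> V \<subseteq> hyperplanes" "openin (top_of_set ?S) (?pre (U \<inter> V))"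
      by (blast, simp only: openin_Int)
  next
    fix K
    assume K: "\<forall>U\<in>K. U \<subseteq> hyperplanes \<and> openin (top_of_set ?S) (?pre U)"
    then show "\<Union>K \<subseteq> hyperplanes" by blast
    have "openin (top_of_set ?S) (\<Union>(?pre ` K))"
      using K by (intro openin_Union) blast
    also have "\<Union>(?pre ` K) = ?pre (\<Union>K)" by blast
    finally show "openin (top_of_set ?S) (?pre (\<Union>K))" .
  qed
  then show ?thesis
    unfolding hyperplane_topology_def by simp
qed

lemma topspace_hyperplane_topology: "topspace hyperplane_topology = hyperplanes"
proof -
  have "{p \<in> sphere (0::'a) 1 \<times> (UNIV::real set). case_prod hyperplane p \<in> hyperplanes}
      = sphere 0 1 \<times> UNIV"
    by (auto simp: hyperplanes_def)
  then have "openin hyperplane_topology (hyperplanes :: 'a set set)"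
    by (simp add: openin_hyperplane_topology)
  then show ?thesis
    by (meson openin_hyperplane_topology openin_subset openin_topspace subset_antisym)
qed

lemma quotient_map_hyperplane:
  "quotient_map (top_of_set (sphere 0 1 \<times> UNIV)) hyperplane_topology (case_prod hyperplane)"
  by (auto simp: quotient_map_def topspace_hyperplane_topology openin_hyperplane_topology
        hyperplanes_def image_iff)

section \<open>Poisson processes\<close>

text \<open>A point process on the measurable space underlying \<open>\<Theta>\<close> is a random measure \<open>X\<close> with
  values in \<open>\<nat> \<union> {\<infinity>}\<close>. The clause for finite \<open>\<Theta> B\<close> includes \<open>\<Theta> B = 0\<close>, where \<open>0 ^ 0 = 1\<close>
  gives the point mass at \<open>0\<close>.\<close>

definition point_process :: "'w measure \<Rightarrow> 'h measure \<Rightarrow> ('w \<Rightarrow> 'h measure) \<Rightarrow> bool" where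
  "point_process P M X \<longleftrightarrow>
     (\<forall>\<omega>\<in>space P. sets (X \<omega>) = sets M \<and>
        (\<forall>B\<in>sets M. emeasure (X \<omega>) B \<in> range ennreal_of_enat)) \<and>
     (\<forall>B\<in>sets M. (\<lambda>\<omega>. emeasure (X \<omega>) B) \<in> borel_measurable P)"

definition poisson_process :: "'w measure \<Rightarrow> 'h measure \<Rightarrow> ('w \<Rightarrow> 'h measure) \<Rightarrow> bool" where
  "poisson_process P \<Theta> X \<longleftrightarrow>
     point_process P \<Theta> X \<and>
     (\<forall>B\<in>sets \<Theta>. emeasure \<Theta> B < \<infinity> \<longrightarrow>
        (\<forall>j::nat. measure P {\<omega>\<in>space P. emeasure (X \<omega>) B = of_nat j}
           = exp (- measure \<Theta> B) * measure \<Theta> B ^ j / fact j)) \<and>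
     (\<forall>B\<in>sets \<Theta>. emeasure \<Theta> B = \<infinity> \<longrightarrow> (AE \<omega> in P. emeasure (X \<omega>) B = \<infinity>)) \<and>
     (\<forall>(m::nat) B. B ` {..<m} \<subseteq> sets \<Theta> \<longrightarrow> disjoint_family_on B {..<m} \<longrightarrow>
        prob_space.indep_vars P (\<lambda>_. borel) (\<lambda>i \<omega>. emeasure (X \<omega>) (B i)) {..<m})"

section \<open>The isotropic hyperplane process and its zero cell\<close>

definition hyperplane_intensity :: "real \<Rightarrow> real \<Rightarrow> 'a::euclidean_space set measure" where
  "hyperplane_intensity \<gamma> r = measure_of hyperplanes (sets hyperplane_borel)
     (\<lambda>B. ennreal (2 * \<gamma> / (real DIM('a) * unit_ball_vol (real DIM('a)))) *
        (\<integral>\<^sup>+u\<in>sphere (0::'a) 1.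
           (\<integral>\<^sup>+t\<in>{0..}. indicator B (hyperplane u t) * ennreal (t powr (r - 1)) \<partial>lborel)
         \<partial>hausdorff_measure (DIM('a) - 1)))"

text \<open>The half-space is unique unless \<open>0 \<in> H\<close>; almost surely, no hyperplane of the process
  contains \<open>0\<close>, so the choice is immaterial.\<close>

definition origin_halfspace :: "'a::euclidean_space set \<Rightarrow> 'a set" where
  "origin_halfspace H =
     (SOME S. 0 \<in> S \<and> (\<exists>u t. u \<in> sphere 0 1 \<and> H = hyperplane u t \<and> S = {x. x \<bullet> u \<le> t}))"

text \<open>The hyperplanes belonging to a counting measure are its atoms.\<close>

definition zero_cell :: "'a::euclidean_space set measure \<Rightarrow> 'a set" where
  "zero_cell \<mu> = (\<Inter>H\<in>{H. emeasure \<mu> {H} > 0}. origin_halfspace H)"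

definition sphere_const :: "'a::euclidean_space \<Rightarrow> real \<Rightarrow> real" where
  "sphere_const e r =
     (LINT u:sphere 0 1|hausdorff_measure (DIM('a) - 1). (max (e \<bullet> u) 0) powr r)"

end

theory Submission
  imports Defs
begin

text \<open>Let \<open>A\<^sub>x\<close> be the set of hyperplanes that strictly separate \<open>x\<close> from the origin. Rotation
  invariance of the surface measure gives \<open>\<Theta>(A\<^sub>x) = a |x|\<^sup>r\<close> with \<open>a = 2 \<gamma> c(n,r) / (n \<kappa>\<^sub>n r)\<close>.
  Almost surely \<open>x\<close> lies in the zero cell iff the process has no point in \<open>A\<^sub>x\<close>, so by Fubini's
  theorem the \<open>k\<close>-th moment is the integral of \<open>exp (- \<Theta>(A\<^bsub>x\<^sub>1\<^esub> \<union> \<dots> \<union> A\<^bsub>x\<^sub>k\<^esub>))\<close> over all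
  \<open>x\<^sub>1, \<dots>, x\<^sub>k\<close>. The exponent lies between the maximum and the sum of the \<open>a |x\<^sub>i|\<^sup>r\<close>; the sum
  makes the integral a product and gives the lower bound, and the maximum gives the upper bound
  by writing \<open>exp (- T)\<close> as the integral of \<open>exp (- s)\<close> over \<open>s \<ge> T\<close>.\<close>

section \<open>Hausdorff measure is a Borel measure\<close>

text \<open>The surface measure is a Hausdorff measure defined by coverings, so all that is required
  of it has to come out of coverings: countable additivity on Borel sets, invariance under
  isometries, and a finite nonzero value on the sphere. Finiteness and positivity carry over to
  c(n,r) and make a positive real number of the scale a, whose reciprocal is the base of the powers
  in the bounds. The other obstacle is that \<open>zero_cell\<close> is built from the atoms of a
  realisation, while the Poisson law prescribes masses of fixed sets. The link is that a realisation
  has values in the natural numbers and \<infinity>: positive finite mass on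
  \<open>separating x\<close> can only come from an atom there. Fubini then asks for measurability
  jointly in outcome and point, so the zero cell is traded for an almost surely equal set for which
  this can be proved. In the upper bound the maximum pays off because the event that it stays below
  a level is a product of balls, so that a single Gamma integral remains. For k = 1 sum and maximum
  coincide, which is why the bounds agree.\<close>

lemma hausdorff_pre_mono: "A \<subseteq> B \<Longrightarrow> hausdorff_pre s \<delta> A \<le> hausdorff_pre s \<delta> B"
  unfolding hausdorff_pre_def by (rule INF_superset_mono) auto

lemma hausdorff_pre_antimono:
  "\<delta> \<le> \<delta>' \<Longrightarrow> hausdorff_pre s \<delta>' A \<le> hausdorff_pre s \<delta> A"
  unfolding hausdorff_pre_def by (rule INF_superset_mono) (auto intro: order_trans)

lemma hausdorff_outer_mono: "A \<subseteq> B \<Longrightarrow> hausdorff_outer s A \<le> hausdorff_outer s B"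
  unfolding hausdorff_outer_def by (intro SUP_mono') (rule hausdorff_pre_mono)

lemma hausdorff_weight_empty [simp]: "hausdorff_weight s {} = 0"
  by (simp add: hausdorff_weight_def)

lemma hausdorff_pre_le:
  assumes "A \<subseteq> (\<Union>i. E i)" "\<And>i. bounded (E i)" "\<And>i. diameter (E i) \<le> \<delta>"
  shows "hausdorff_pre s \<delta> A \<le> (\<Sum>i. hausdorff_weight s (E i))"
  unfolding hausdorff_pre_def by (rule INF_lower) (use assms in auto)

lemma hausdorff_outer_empty [simp]: "hausdorff_outer s {} = 0"
proof -
  have "hausdorff_pre s \<delta> {} = 0" if "\<delta> > 0" for \<delta>
    using hausdorff_pre_le[of "{}" "\<lambda>_. {}" \<delta> s] that by simp
  then have "hausdorff_outer s {} \<le> 0"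
    unfolding hausdorff_outer_def by (intro SUP_least) auto
  then show ?thesis by simp
qed

text \<open>Coverings of \<open>A i\<close> that exceed the infimum by at most
  \<open>e / 2 ^ (i + 1)\<close> are merged into one sequence by \<open>prod_decode\<close>; the
  excesses add up to \<open>e\<close>.\<close>

lemma hausdorff_pre_UN_le:
  "hausdorff_pre s \<delta> (\<Union>i. A i) \<le> (\<Sum>i::nat. hausdorff_pre s \<delta> (A i))"
proof (rule ennreal_le_epsilon)
  fix e :: real
  assume fin: "(\<Sum>i. hausdorff_pre s \<delta> (A i)) < top" and e: "0 < e"
  have "\<exists>E. A i \<subseteq> (\<Union>j. E j) \<and> (\<forall>j::nat. bounded (E j) \<and> diameter (E j) \<le> \<delta>) \<and>
          (\<Sum>j. hausdorff_weight s (E j)) \<le> hausdorff_pre s \<delta> (A i) + ennreal (e * (1/2) ^ Suc i)" for i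
  proof -
    have "hausdorff_pre s \<delta> (A i) \<noteq> top"
      using fin ennreal_suminf_lessD by (metis less_irrefl)
    then have "hausdorff_pre s \<delta> (A i) < hausdorff_pre s \<delta> (A i) + ennreal (e * (1/2) ^ Suc i)"
      using e by (simp add: ennreal_add_left_cancel_less[where c=0, simplified] less_top)
    then show ?thesis
      unfolding hausdorff_pre_def[of s \<delta> "A i"] INF_less_iff
      by (auto intro: less_imp_le)
  qed
  then obtain E where E: "\<And>i. A i \<subseteq> (\<Union>j. E i j)"
      "\<And>i j::nat. bounded (E i j)" "\<And>i j. diameter (E i j) \<le> \<delta>"
      "\<And>i. (\<Sum>j. hausdorff_weight s (E i j)) \<le> hausdorff_pre s \<delta> (A i) + ennreal (e * (1/2) ^ Suc i)"
    by metis
  define C where "C k = case_prod E (prod_decode k)" for k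
  have "(\<Union>i. A i) \<subseteq> (\<Union>k. C k)"
  proof
    fix x assume "x \<in> (\<Union>i. A i)"
    then obtain i j where "x \<in> E i j" using E(1) by blast
    then have "x \<in> C (prod_encode (i, j))" by (simp add: C_def)
    then show "x \<in> (\<Union>k. C k)" by blast
  qed
  then have "hausdorff_pre s \<delta> (\<Union>i. A i) \<le> (\<Sum>k. hausdorff_weight s (C k))"
    by (rule hausdorff_pre_le) (auto simp: C_def E split: prod.split)
  also have "\<dots> = (\<Sum>i. \<Sum>j. hausdorff_weight s (E i j))"
    unfolding C_def
    using suminf_ennreal_2dimen[of "\<lambda>i. \<Sum>j. hausdorff_weight s (E i j)" "\<lambda>(i, j). hausdorff_weight s (E i j)"]
    by (simp add: case_prod_unfold)
  also have "\<dots> \<le> (\<Sum>i. hausdorff_pre s \<delta> (A i) + ennreal (e * (1/2) ^ Suc i))"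
    by (intro suminf_le E(4)) auto
  also have "\<dots> = (\<Sum>i. hausdorff_pre s \<delta> (A i)) + (\<Sum>i. ennreal (e * (1/2) ^ Suc i))"
    by (rule suminf_add[symmetric]) auto
  also have "(\<Sum>i. ennreal (e * (1/2) ^ Suc i)) = ennreal e"
    by (rule suminf_ennreal_eq) (use e sums_mult[OF power_half_series, of e] in auto)
  finally show "hausdorff_pre s \<delta> (\<Union>i. A i) \<le> (\<Sum>i. hausdorff_pre s \<delta> (A i)) + ennreal e" .
qed

lemma hausdorff_outer_UN_le:
  "hausdorff_outer s (\<Union>i. A i) \<le> (\<Sum>i::nat. hausdorff_outer s (A i))"
  unfolding hausdorff_outer_def[of s "\<Union>i. A i"]
proof (rule SUP_least)
  fix \<delta> :: real assume "\<delta> \<in> {0<..}"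
  then have "hausdorff_pre s \<delta> (A i) \<le> hausdorff_outer s (A i)" for i
    unfolding hausdorff_outer_def by (rule SUP_upper)
  then show "hausdorff_pre s \<delta> (\<Union>i. A i) \<le> (\<Sum>i. hausdorff_outer s (A i))"
    by (intro order_trans[OF hausdorff_pre_UN_le] suminf_le) auto
qed

lemma hausdorff_outer_Un_le:
  "hausdorff_outer s (A \<union> B) \<le> hausdorff_outer s A + hausdorff_outer s B"
proof -
  have "hausdorff_outer s (\<Union>i. binaryset A B i) \<le> (\<Sum>i. hausdorff_outer s (binaryset A B i))"
    by (rule hausdorff_outer_UN_le)
  then show ?thesis
    by (simp add: UN_binaryset_eq suminf_binaryset_eq)
qed

section \<open>Additivity over separated sets and Caratheodory's criterion\<close>

text \<open>A covering set of diameter at most \<delta> cannot meet both \<open>A\<close> and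
  \<open>B\<close>, so every covering of the union splits into two at no cost: in \<open>F C\<close>
  the sets that miss \<open>C\<close> are replaced by the empty set, whose weight is 0.\<close>

lemma hausdorff_pre_separated:
  assumes sep: "\<And>a b. a \<in> A \<Longrightarrow> b \<in> B \<Longrightarrow> \<delta> < dist a b"
  shows "hausdorff_pre s \<delta> A + hausdorff_pre s \<delta> B \<le> hausdorff_pre s \<delta> (A \<union> B)"
  unfolding hausdorff_pre_def[of s \<delta> "A \<union> B"]
proof (rule INF_greatest, clarify)
  fix E :: "nat \<Rightarrow> 'a set"
  assume E: "A \<union> B \<subseteq> (\<Union>i. E i)" "\<forall>i. bounded (E i) \<and> diameter (E i) \<le> \<delta>"
  define F where "F C i = (if E i \<inter> C = {} then {} else E i)" for C i
  have "E i \<inter> A = {} \<or> E i \<inter> B = {}" for i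
    using diameter_bounded_bound[of "E i"] E(2) sep by (metis Int_emptyI order_trans not_le)
  then have w: "hausdorff_weight s (F A i) + hausdorff_weight s (F B i) \<le> hausdorff_weight s (E i)" for i
    by (metis F_def add.left_neutral add.right_neutral hausdorff_weight_empty order_refl zero_le)
  have le: "hausdorff_pre s \<delta> C \<le> (\<Sum>i. hausdorff_weight s (F C i))" if "C \<subseteq> A \<union> B" for C
  proof (rule hausdorff_pre_le)
    show "C \<subseteq> (\<Union>i. F C i)"
      using that E(1) by (auto simp: F_def) blast
    fix i show "bounded (F C i)" using E(2) by (simp add: F_def)
    have "0 \<le> \<delta>" using E(2) diameter_ge_0 order_trans by blast
    then show "diameter (F C i) \<le> \<delta>" using E(2) by (simp add: F_def diameter_empty)
  qed
  have "hausdorff_pre s \<delta> A + hausdorff_pre s \<delta> B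
      \<le> (\<Sum>i. hausdorff_weight s (F A i)) + (\<Sum>i. hausdorff_weight s (F B i))"
    by (intro add_mono le) auto
  also have "\<dots> = (\<Sum>i. hausdorff_weight s (F A i) + hausdorff_weight s (F B i))"
    by (rule suminf_add) auto
  also have "\<dots> \<le> (\<Sum>i. hausdorff_weight s (E i))"
    by (intro suminf_le w) auto
  finally show "hausdorff_pre s \<delta> A + hausdorff_pre s \<delta> B \<le> (\<Sum>i. hausdorff_weight s (E i))" .
qed

lemma hausdorff_outer_separated:
  assumes "\<epsilon> > 0" and sep: "\<And>a b. a \<in> A \<Longrightarrow> b \<in> B \<Longrightarrow> \<epsilon> \<le> dist a b"
  shows "hausdorff_outer s A + hausdorff_outer s B \<le> hausdorff_outer s (A \<union> B)"
proof -
  have "hausdorff_pre s \<delta>\<^sub>1 A + hausdorff_pre s \<delta>\<^sub>2 B \<le> hausdorff_outer s (A \<union> B)"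
    if "\<delta>\<^sub>1 > 0" "\<delta>\<^sub>2 > 0" for \<delta>\<^sub>1 \<delta>\<^sub>2
  proof -
    \<comment> \<open>Shrinking the scale only increases the pre-measures, so one common scale
      serves both. Halving \<epsilon> turns the weak separation into the strict one needed at a
      fixed scale.\<close>
    define \<delta> where "\<delta> = min (min \<delta>\<^sub>1 \<delta>\<^sub>2) (\<epsilon> / 2)"
    have \<delta>: "\<delta> > 0" "\<delta> < \<epsilon>" "\<delta> \<le> \<delta>\<^sub>1" "\<delta> \<le> \<delta>\<^sub>2" using assms(1) that by (auto simp: \<delta>_def)
    have "hausdorff_pre s \<delta>\<^sub>1 A + hausdorff_pre s \<delta>\<^sub>2 B \<le> hausdorff_pre s \<delta> A + hausdorff_pre s \<delta> B"
      by (intro add_mono hausdorff_pre_antimono \<delta>)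
    also have "\<dots> \<le> hausdorff_pre s \<delta> (A \<union> B)"
      using sep \<delta>(2) by (intro hausdorff_pre_separated) force
    also have "\<dots> \<le> hausdorff_outer s (A \<union> B)"
      unfolding hausdorff_outer_def by (rule SUP_upper) (use \<delta> in auto)
    finally show ?thesis .
  qed
  then have "(SUP \<delta>\<^sub>1\<in>{0<..}. SUP \<delta>\<^sub>2\<in>{0<..}. hausdorff_pre s \<delta>\<^sub>1 A + hausdorff_pre s \<delta>\<^sub>2 B)
      \<le> hausdorff_outer s (A \<union> B)"
    by (intro SUP_least) auto
  then show ?thesis
    unfolding hausdorff_outer_def[of s A] hausdorff_outer_def[of s B]
    by (subst ennreal_SUP_add_left[symmetric], simp)+
       (simp add: ennreal_SUP_add_right)
qed

text \<open>The layers \<open>R (Suc k)\<close> and the sets \<open>D k\<close> have positive distance, so the measures of the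
  layers telescope and their tail sums tend to \<open>0\<close>.\<close>

lemma closed_hausdorff_split:
  fixes C T :: "'a::metric_space set"
  assumes "closed C"
  shows "hausdorff_outer s (T \<inter> C) + hausdorff_outer s (T - C) \<le> hausdorff_outer s T"
proof (cases "hausdorff_outer s T = \<infinity> \<or> C = {}")
  case True
  then show ?thesis by (cases "C = {}") auto
next
  case False
  let ?f = "hausdorff_outer s"
  define D where "D k = {x\<in>T. inverse (real (Suc k)) \<le> infdist x C}" for k
  define R where "R k = D (Suc k) - D k" for k
  have inv: "inverse (real (Suc (Suc k))) < inverse (real (Suc k))" for k
    by simp
  have D_mono: "D k \<subseteq> D (Suc k)" for k
    unfolding D_def by (intro Collect_mono conj_mono impI) (use inv[of k] in linarith)+
  have pos: "infdist x C > 0" if "x \<in> T - C" for x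
    using infdist_pos_not_in_closed[OF assms] False that by blast
  have step: "?f (D k) + ?f (R (Suc k)) \<le> ?f (D (Suc (Suc k)))" for k
  proof -
    have "?f (D k) + ?f (R (Suc k)) \<le> ?f (D k \<union> R (Suc k))"
    proof (rule hausdorff_outer_separated)
      fix a b assume ab: "a \<in> D k" "b \<in> R (Suc k)"
      then have "inverse (real (Suc k)) \<le> infdist a C" "infdist b C < inverse (real (Suc (Suc k)))"
        by (auto simp: D_def R_def)
      then show "inverse (real (Suc k)) - inverse (real (Suc (Suc k))) \<le> dist a b"
        using infdist_triangle[of a C b] by linarith
    qed (use inv[of k] in auto)
    also have "\<dots> \<le> ?f (D (Suc (Suc k)))"
      by (intro hausdorff_outer_mono) (use D_mono in \<open>auto simp: R_def\<close>)
    finally show ?thesis .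
  qed
  \<comment> \<open>\<open>step\<close> advances by two indices, so even and odd layers telescope
    separately; carrying two consecutive sets \<open>D N\<close> and \<open>D (Suc N)\<close> treats
    both chains in one induction.\<close>
  have partial: "(\<Sum>j<N. ?f (R (Suc j))) + ?f (D 0) + ?f (D 1) \<le> ?f (D N) + ?f (D (Suc N))" for N
  proof (induction N)
    case (Suc N)
    have "(\<Sum>j<Suc N. ?f (R (Suc j))) + ?f (D 0) + ?f (D 1)
        = (\<Sum>j<N. ?f (R (Suc j))) + ?f (D 0) + ?f (D 1) + ?f (R (Suc N))"
      by (simp add: ac_simps)
    also have "\<dots> \<le> ?f (D N) + ?f (D (Suc N)) + ?f (R (Suc N))"
      by (intro add_mono Suc order_refl)
    also have "\<dots> \<le> ?f (D (Suc N)) + ?f (D (Suc (Suc N)))"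
      using add_left_mono[OF step[of N], of "?f (D (Suc N))"] by (simp add: ac_simps)
    finally show ?case .
  qed simp
  have D_le: "?f (D k) \<le> ?f T" for k
    by (intro hausdorff_outer_mono) (auto simp: D_def)
  define S where "S = (\<Sum>j. ?f (R j))"
  have "(\<Sum>j. ?f (R (Suc j))) \<le> ?f T + ?f T"
  proof (rule suminf_le_const)
    fix N
    have "(\<Sum>j<N. ?f (R (Suc j))) \<le> (\<Sum>j<N. ?f (R (Suc j))) + (?f (D 0) + ?f (D 1))"
      by simp
    also have "\<dots> \<le> ?f (D N) + ?f (D (Suc N))" using partial[of N] by (simp add: ac_simps)
    also have "\<dots> \<le> ?f T + ?f T" by (intro add_mono D_le)
    finally show "(\<Sum>j<N. ?f (R (Suc j))) \<le> ?f T + ?f T" .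
  qed auto
  then have "(\<Sum>j. ?f (R (Suc j))) < \<infinity>"
    using False by (auto simp: less_top[symmetric] top_unique)
  moreover have "?f (R 0) \<le> ?f T"
    by (intro hausdorff_outer_mono) (auto simp: R_def D_def)
  then have "?f (R 0) < \<infinity>"
    using False by (auto simp: less_top[symmetric] top_unique)
  moreover have "S = (\<Sum>j. ?f (R (j + 1))) + (\<Sum>j<1. ?f (R j))"
    unfolding S_def by (rule suminf_offset[of "\<lambda>j. ?f (R j)" 1]) auto
  ultimately have S_fin: "S < \<infinity>" by simp
  \<comment> \<open>Adding the partial sums of the layers to the left side replaces a limit of
    vanishing tails by a supremum; the finite total \<open>S\<close> is cancelled at the
    end.\<close>
  have "?f (T \<inter> C) + ?f (T - C) + (\<Sum>j<k. ?f (R j)) \<le> ?f T + S" for k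
  proof -
    have "T - C \<subseteq> D k \<union> (\<Union>j. R (j + k))"
    proof
      fix x assume x: "x \<in> T - C"
      obtain m where "inverse (real (Suc m)) < infdist x C"
        using reals_Archimedean[OF pos[OF x]] by blast
      then have xm: "x \<in> D m" using x by (auto simp: D_def)
      define l where "l = (LEAST m. x \<in> D m)"
      have l: "x \<in> D l" unfolding l_def using xm by (rule LeastI)
      show "x \<in> D k \<union> (\<Union>j. R (j + k))"
      proof (cases "l \<le> k")
        case True
        then show ?thesis using l lift_Suc_mono_le[of D, OF D_mono] by blast
      next
        case False
        then obtain l' where l': "l = Suc l'" "k \<le> l'" by (cases l) auto
        have "x \<notin> D l'" using not_less_Least[of l' "\<lambda>m. x \<in> D m"] l' by (simp add: l_def)
        then have "x \<in> R ((l' - k) + k)" using l l' by (simp add: R_def)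
        then show ?thesis by blast
      qed
    qed
    then have "?f (T - C) \<le> ?f (D k \<union> (\<Union>j. R (j + k)))"
      by (rule hausdorff_outer_mono)
    also have "\<dots> \<le> ?f (D k) + (\<Sum>j. ?f (R (j + k)))"
      by (rule order_trans[OF hausdorff_outer_Un_le add_left_mono[OF hausdorff_outer_UN_le]])
    finally have 1: "?f (T - C) \<le> ?f (D k) + (\<Sum>j. ?f (R (j + k)))" .
    have "?f (T \<inter> C) + ?f (D k) \<le> ?f (T \<inter> C \<union> D k)"
    proof (rule hausdorff_outer_separated)
      fix a b assume "a \<in> T \<inter> C" "b \<in> D k"
      then show "inverse (real (Suc k)) \<le> dist a b"
        using infdist_le[of a C b] by (auto simp: D_def dist_commute)
    qed auto
    also have "\<dots> \<le> ?f T" by (intro hausdorff_outer_mono) (auto simp: D_def)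
    finally have 2: "?f (T \<inter> C) + ?f (D k) \<le> ?f T" .
    have 3: "S = (\<Sum>j. ?f (R (j + k))) + (\<Sum>j<k. ?f (R j))"
      unfolding S_def by (rule suminf_offset[of "\<lambda>j. ?f (R j)" k]) auto
    have "?f (T \<inter> C) + ?f (T - C) + (\<Sum>j<k. ?f (R j))
        \<le> ?f (T \<inter> C) + (?f (D k) + (\<Sum>j. ?f (R (j + k)))) + (\<Sum>j<k. ?f (R j))"
      by (intro add_mono 1 order_refl)
    also have "\<dots> = (?f (T \<inter> C) + ?f (D k)) + S" by (simp add: 3 ac_simps)
    also have "\<dots> \<le> ?f T + S" by (intro add_mono 2 order_refl)
    finally show ?thesis .
  qed
  then have "(SUP k. ?f (T \<inter> C) + ?f (T - C) + (\<Sum>j<k. ?f (R j))) \<le> ?f T + S"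
    by (rule SUP_least)
  moreover have "(SUP k. ?f (T \<inter> C) + ?f (T - C) + (\<Sum>j<k. ?f (R j))) = ?f (T \<inter> C) + ?f (T - C) + S"
    unfolding S_def suminf_eq_SUP by (rule ennreal_SUP_add_right[symmetric]) simp
  ultimately have "?f (T \<inter> C) + ?f (T - C) + S \<le> ?f T + S"
    by simp
  then have "S + (?f (T \<inter> C) + ?f (T - C)) \<le> S + ?f T"
    by (metis add.commute)
  then show ?thesis
    using S_fin by (auto simp: ennreal_add_left_cancel_le)
qed

section \<open>The induced Borel measure\<close>

lemma sets_hausdorff_measure [simp, measurable_cong]: "sets (hausdorff_measure s) = sets borel"
  unfolding hausdorff_measure_def using sets.sigma_sets_eq[of borel]
  by (simp add: sets_measure_of space_borel)

lemma space_hausdorff_measure [simp]: "space (hausdorff_measure s) = UNIV"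
  unfolding hausdorff_measure_def by (simp add: space_measure_of)

text \<open>\<open>measure_of\<close> keeps the prescribed values only if they are countably
  additive. By Caratheodory the sets that split every set additively form a sigma-algebra on which
  the outer measure is countably additive; closed sets belong to it, hence so do all Borel
  sets.\<close>

lemma emeasure_hausdorff_measure:
  fixes A :: "'a::metric_space set"
  assumes "A \<in> sets borel"
  shows "emeasure (hausdorff_measure s) A = hausdorff_outer s A"
proof (rule emeasure_measure_of[OF hausdorff_measure_def])
  let ?L = "lambda_system UNIV (Pow (UNIV :: 'a set)) (hausdorff_outer s)"
  interpret sigma_algebra UNIV "Pow (UNIV :: 'a set)" by (rule sigma_algebra_Pow)
  have "measure_space UNIV ?L (hausdorff_outer s)"
    by (rule caratheodory_lemma)
       (auto simp: outer_measure_space_def positive_def increasing_def countably_subadditive_def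
             intro: hausdorff_outer_mono hausdorff_outer_UN_le)
  then have L: "sigma_algebra UNIV ?L" "countably_additive ?L (hausdorff_outer s)"
    by (auto simp: measure_space_def)
  have "C \<in> ?L" if "closed C" for C
    unfolding lambda_system_eq
  proof (clarsimp, rule antisym)
    fix T
    show "hausdorff_outer s (T \<inter> C) + hausdorff_outer s (T - C) \<le> hausdorff_outer s T"
      by (rule closed_hausdorff_split[OF that])
    show "hausdorff_outer s T \<le> hausdorff_outer s (T \<inter> C) + hausdorff_outer s (T - C)"
      using hausdorff_outer_Un_le[of s "T \<inter> C" "T - C"] by (simp add: Int_Diff_Un)
  qed
  then have "sigma_sets UNIV (Collect closed) \<subseteq> ?L"
    by (intro sigma_algebra.sigma_sets_subset[OF L(1)]) auto
  then have "sets borel \<subseteq> ?L"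
    by (simp add: borel_eq_closed)
  then have sub: "sets (hausdorff_measure s :: 'a measure) \<subseteq> ?L"
    by simp
  show "countably_additive (sets (hausdorff_measure s :: 'a measure)) (hausdorff_outer s)"
  proof (rule countably_additiveI)
    fix A :: "nat \<Rightarrow> 'a set"
    assume "range A \<subseteq> sets (hausdorff_measure s)" "disjoint_family A"
      "(\<Union>i. A i) \<in> sets (hausdorff_measure s)"
    then show "(\<Sum>i. hausdorff_outer s (A i)) = hausdorff_outer s (\<Union>i. A i)"
      by (intro L(2)[unfolded countably_additive_def, rule_format] subset_trans[OF _ sub] subsetD[OF sub])
  qed
  show "positive (sets (hausdorff_measure s :: 'a measure)) (hausdorff_outer s)"
    by (simp add: positive_def)
qed (use assms in auto)

section \<open>Hausdorff measure on the sphere\<close>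

lemma sphere_in_borel [measurable, simp]: "sphere (a::'a::euclidean_space) r \<in> sets borel"
  by (intro borel_closed closed_sphere)

section \<open>Finite surface measure by packing\<close>

lemma hausdorff_pre_le_finite:
  assumes "finite F" "A \<subseteq> (\<Union>p\<in>F. E p)" "\<And>p. p \<in> F \<Longrightarrow> bounded (E p)"
    and "\<And>p. p \<in> F \<Longrightarrow> diameter (E p) \<le> \<delta>" "0 \<le> \<delta>"
  shows "hausdorff_pre s \<delta> A \<le> (\<Sum>p\<in>F. hausdorff_weight s (E p))"
proof -
  obtain f where f: "bij_betw f {..<card F} F"
    using ex_bij_betw_nat_finite[OF assms(1)] by (auto simp: atLeast0LessThan)
  define G where "G i = (if i < card F then E (f i) else {})" for i
  have fF: "f i \<in> F" if "i < card F" for i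
    using f that by (auto simp: bij_betw_def)
  have "hausdorff_pre s \<delta> A \<le> (\<Sum>i. hausdorff_weight s (G i))"
  proof (rule hausdorff_pre_le)
    show "A \<subseteq> (\<Union>i. G i)"
    proof
      fix x assume "x \<in> A"
      then obtain p where "p \<in> F" "x \<in> E p" using assms(2) by blast
      moreover obtain i where "i < card F" "f i = p"
        using bij_betw_imp_surj_on[OF f] \<open>p \<in> F\<close> by (metis imageE lessThan_iff)
      ultimately have "x \<in> G i" by (simp add: G_def)
      then show "x \<in> (\<Union>i. G i)" by blast
    qed
    show "bounded (G i)" "diameter (G i) \<le> \<delta>" for i
      using assms(3)[OF fF, of i] assms(4)[OF fF, of i] assms(5) by (simp_all add: G_def)
  qed
  also have "\<dots> = (\<Sum>i<card F. hausdorff_weight s (G i))"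
    by (rule suminf_finite) (auto simp: G_def)
  also have "\<dots> = (\<Sum>i<card F. hausdorff_weight s (E (f i)))"
    by (simp add: G_def)
  also have "\<dots> = (\<Sum>p\<in>F. hausdorff_weight s (E p))"
    using f by (rule sum.reindex_bij_betw)
  finally show ?thesis .
qed

text \<open>Bounds the volume of the shell between the radii \<open>1 - h\<close> and
  \<open>1 + h\<close> linearly in \<open>h\<close>. The base 4 is the sum of the two factors 2 that
  arise in the induction step.\<close>

lemma power_diff_le_linear:
  fixes h :: real
  assumes "0 \<le> h" "h \<le> 1"
  shows "(1 + h) ^ n \<le> (1 - h) ^ n + h * 4 ^ n"
proof (induction n)
  case (Suc n)
  have 1: "(1 - h) ^ n \<le> 1" using assms by (simp add: power_le_one)
  have 2: "(1 - h) ^ n \<le> 4 ^ n" by (rule order_trans[OF 1]) simp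
  have "(1 + h) ^ Suc n \<le> (1 + h) * ((1 - h) ^ n + h * 4 ^ n)"
    using Suc assms by (simp add: mult_left_mono)
  also have "\<dots> = (1 - h) ^ Suc n + 2 * h * (1 - h) ^ n + (1 + h) * (h * 4 ^ n)"
    by (simp add: algebra_simps)
  also have "2 * h * (1 - h) ^ n \<le> 2 * h * 4 ^ n"
    using assms 2 by (intro mult_left_mono) auto
  also have "(1 + h) * (h * 4 ^ n) \<le> 2 * (h * 4 ^ n)"
    using assms by (intro mult_right_mono) auto
  finally show ?case by simp
qed (use assms in simp)

text \<open>The balls of radius \<open>h\<close> about the points are disjoint and lie in a shell of
  volume of order \<open>h\<close>; division by the volume of one ball, of order
  \<open>h ^ n\<close>, leaves the exponent \<open>n - 1\<close>.\<close>

lemma sphere_packing_card: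
  fixes F :: "'a::euclidean_space set"
  assumes F: "finite F" "F \<subseteq> sphere 0 1" and h: "0 < h" "h \<le> 1"
    and sep: "\<And>p q. p \<in> F \<Longrightarrow> q \<in> F \<Longrightarrow> p \<noteq> q \<Longrightarrow> 2 * h \<le> dist p q"
  shows "real (card F) * h ^ (DIM('a) - 1) \<le> 4 ^ DIM('a)"
proof -
  let ?n = "DIM('a)" and ?\<kappa> = "unit_ball_vol (real DIM('a))"
  define U where "U = (\<Union>p\<in>F. ball p h)"
  have fin: "emeasure lborel (ball p s) < \<infinity>" for p :: 'a and s
    by (rule emeasure_bounded_finite) simp
  have disj: "disjoint_family_on (\<lambda>p. ball p h) F"
    unfolding disjoint_family_on_def
  proof (intro ballI impI)
    fix p q assume "p \<in> F" "q \<in> F" "p \<noteq> q"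
    then show "ball p h \<inter> ball q h = {}"
      using sep[of p q] dist_triangle_half_l[of p _ "2 * h" q] by (force simp: dist_commute)
  qed
  have "measure lborel U = (\<Sum>p\<in>F. measure lborel (ball p h))"
    unfolding U_def by (rule measure_finite_Union) (use F disj fin in \<open>auto simp: less_top\<close>)
  then have U: "measure lborel U = card F * (?\<kappa> * h ^ ?n)"
    using h by (simp add: content_ball)
  have normF: "norm p = 1" if "p \<in> F" for p using F(2) that by auto
  have "U \<inter> ball 0 (1 - h) = {}"
  proof (safe, simp add: U_def, clarify)
    fix x p assume "p \<in> F" "dist p x < h" "norm x < 1 - h"
    then show False
      using normF[of p] norm_triangle_sub[of p x] by (simp add: dist_norm)
  qed
  moreover have "emeasure lborel U < \<infinity>"
    by (rule emeasure_bounded_finite) (use F in \<open>auto simp: U_def\<close>)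
  moreover have "U \<in> sets lborel" by (simp add: U_def borel_open open_UN)
  ultimately have "measure lborel (U \<union> ball 0 (1 - h)) = measure lborel U + measure lborel (ball (0::'a) (1 - h))"
    using fin by (intro measure_Union) (auto simp: less_top)
  moreover have "measure lborel (U \<union> ball 0 (1 - h)) \<le> measure lborel (ball (0::'a) (1 + h))"
  proof (rule measure_mono_fmeasurable)
    show "U \<union> ball 0 (1 - h) \<subseteq> ball 0 (1 + h)"
    proof
      fix x assume "x \<in> U \<union> ball 0 (1 - h)"
      then consider p where "p \<in> F" "dist p x < h" | "norm x < 1 - h" by (auto simp: U_def)
      then show "x \<in> ball 0 (1 + h)"
      proof cases
        case 1
        then show ?thesis
          using normF[of p] norm_triangle_sub[of x p] by (simp add: dist_norm norm_minus_commute)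
      qed (use h in auto)
    qed
  qed (use fin in \<open>auto simp: U_def fmeasurable_def borel_open open_UN\<close>)
  ultimately have "card F * (?\<kappa> * h ^ ?n) + ?\<kappa> * (1 - h) ^ ?n \<le> ?\<kappa> * (1 + h) ^ ?n"
    using U h by (simp add: content_ball)
  also have "\<dots> \<le> ?\<kappa> * ((1 - h) ^ ?n + h * 4 ^ ?n)"
    using h by (intro mult_left_mono power_diff_le_linear) auto
  finally have "?\<kappa> * h * (card F * h ^ (?n - 1)) \<le> ?\<kappa> * h * 4 ^ ?n"
    by (simp add: algebra_simps flip: power_minus_mult[of ?n h])
  moreover have "?\<kappa> * h > 0" using h by simp
  ultimately show ?thesis by (simp only: mult_le_cancel_left_pos)
qed

text \<open>A \<open>2 * h\<close>-separated set of largest cardinality is a net: any uncovered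
  point could be added to it. The balls about its points have total weight bounded by the packing
  estimate, uniformly in the scale.\<close>

lemma hausdorff_outer_sphere_finite:
  "hausdorff_outer (DIM('a) - 1) (sphere 0 1 :: 'a::euclidean_space set) < \<infinity>"
proof -
  let ?n = "DIM('a)" and ?S = "sphere 0 1 :: 'a set"
  define C where "C = unit_ball_vol (real (?n - 1)) * 2 ^ (?n - 1) * 4 ^ ?n"
  have "hausdorff_pre (?n - 1) \<delta> ?S \<le> ennreal C" if "\<delta> > 0" for \<delta>
  proof -
    \<comment> \<open>The covering balls have radius \<open>2 * h\<close> and diameter
      \<open>4 * h\<close>, which must not exceed \<delta>; the packing estimate wants
      \<open>h\<close> at most 1.\<close>
    define h where "h = min \<delta> 1 / 4"
    have h: "0 < h" "h \<le> 1" "4 * h \<le> \<delta>" using that by (auto simp: h_def)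
    define Q where "Q F \<longleftrightarrow> finite F \<and> F \<subseteq> ?S \<and> (\<forall>p\<in>F. \<forall>q\<in>F. p \<noteq> q \<longrightarrow> 2 * h \<le> dist p q)" for F
    have card_le: "real (card F) * h ^ (?n - 1) \<le> 4 ^ ?n" if "Q F" for F
      using that h by (intro sphere_packing_card) (auto simp: Q_def)
    have "\<exists>F. Q F \<and> (\<forall>G. Q G \<longrightarrow> card G \<le> card F)"
    proof (rule ex_has_greatest_nat)
      show "Q {}" by (simp add: Q_def)
      show "\<forall>G. Q G \<longrightarrow> card G < Suc (nat \<lfloor>4 ^ ?n / h ^ (?n - 1)\<rfloor>)"
        using card_le h by (auto simp: le_nat_iff le_floor_iff pos_le_divide_eq intro!: le_imp_less_Suc)
    qed
    then obtain F where F: "Q F" "\<And>G. Q G \<Longrightarrow> card G \<le> card F" by blast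
    have "?S \<subseteq> (\<Union>p\<in>F. cball p (2 * h))"
    proof
      fix x assume x: "x \<in> ?S"
      show "x \<in> (\<Union>p\<in>F. cball p (2 * h))"
      proof (rule ccontr)
        assume "x \<notin> (\<Union>p\<in>F. cball p (2 * h))"
        then have far: "\<And>p. p \<in> F \<Longrightarrow> 2 * h < dist p x" by (auto simp: not_le)
        then have "x \<notin> F" using h by force
        moreover have "Q (insert x F)"
          using F(1) x far by (auto simp: Q_def dist_commute less_imp_le)
        ultimately show False using F(2)[of "insert x F"] F(1) by (simp add: Q_def)
      qed
    qed
    then have "hausdorff_pre (?n - 1) \<delta> ?S \<le> (\<Sum>p\<in>F. hausdorff_weight (?n - 1) (cball p (2 * h)))"
      using F(1) h that by (intro hausdorff_pre_le_finite) (auto simp: Q_def)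
    also have "\<dots> = (\<Sum>p\<in>F. ennreal (unit_ball_vol (real (?n - 1)) * (2 * h) ^ (?n - 1)))"
      using h by (intro sum.cong) (auto simp: hausdorff_weight_def)
    also have "\<dots> = ennreal (\<Sum>p\<in>F. unit_ball_vol (real (?n - 1)) * (2 * h) ^ (?n - 1))"
      using h by (intro sum_ennreal) auto
    also have "\<dots> = ennreal (unit_ball_vol (real (?n - 1)) * 2 ^ (?n - 1) * (card F * h ^ (?n - 1)))"
      by (simp add: power_mult_distrib ac_simps)
    also have "\<dots> \<le> ennreal C"
      unfolding C_def by (intro ennreal_leI mult_left_mono card_le F(1)) auto
    finally show ?thesis .
  qed
  then have "hausdorff_outer (?n - 1) ?S \<le> ennreal C"
    unfolding hausdorff_outer_def by (intro SUP_least) auto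
  also have "\<dots> < \<infinity>" by (simp add: less_top[symmetric])
  finally show ?thesis .
qed

section \<open>Positive surface measure by the volume of cones\<close>

text \<open>A spherical set of diameter \<open>d\<close> spans a truncated cone that is covered by about \<open>1 / d\<close> balls
  of radius \<open>3 d\<close>.\<close>

lemma cone_cover:
  fixes p :: "'a::euclidean_space"
  assumes n: "DIM('a) \<ge> 2" and E: "E \<subseteq> sphere 0 1" "p \<in> E" "\<And>u. u \<in> E \<Longrightarrow> dist u p \<le> d"
    and d: "0 \<le> d" "d \<le> 1"
  obtains G where "G \<in> sets borel" "\<And>t u. t \<in> {1..2} \<Longrightarrow> u \<in> E \<Longrightarrow> t *\<^sub>R u \<in> G"
    "emeasure lborel G \<le> ennreal (2 * 3 ^ DIM('a) * unit_ball_vol (real DIM('a)) * d ^ (DIM('a) - 1))"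
proof (cases "d = 0")
  case True
  \<comment> \<open>The bound to be met is exactly 0 here, since the exponent
    \<open>DIM('a) - 1\<close> is positive. The cone lies on the line through \<open>p\<close>,
    which is a null set in dimension at least 2.\<close>
  have "dim (span {p}) < DIM('a)"
    using n by (simp add: dim_singleton)
  then have "negligible (span {p})" by (rule negligible_lowdim)
  moreover have "span {p} \<in> sets borel" by (simp add: borel_closed closed_subspace)
  ultimately have "emeasure lborel (span {p}) = 0"
    by (simp add: negligible_iff_null_sets null_sets_def)
  moreover have "t *\<^sub>R u \<in> span {p}" if "u \<in> E" for t u
    using E(3)[OF that] True by (auto intro: span_mul span_base)
  ultimately show ?thesis
    using \<open>span {p} \<in> sets borel\<close> by (intro that[of "span {p}"]) auto
next
  case False
  let ?n = "DIM('a)" and ?\<kappa> = "unit_ball_vol (real DIM('a))"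
  have d0: "d > 0" using False d by simp
  define N where "N = nat \<lfloor>1 / d\<rfloor>"
  \<comment> \<open>The centres run along the ray of \<open>p\<close> from norm 1 to about 2 in
    steps of \<open>d\<close>. Rounding \<open>t\<close> to a step costs at most \<open>d\<close>,
    replacing \<open>u\<close> by \<open>p\<close> at most \<open>2 * d\<close>; hence the radius
    \<open>3 * d\<close>.\<close>
  define G where "G = (\<Union>j\<le>N. cball ((1 + real j * d) *\<^sub>R p) (3 * d))"
  have normE: "norm u = 1" if "u \<in> E" for u using E(1) that by auto
  show ?thesis
  proof (rule that[of G])
    show "G \<in> sets borel" by (simp add: G_def)
    fix t u assume t: "t \<in> {1..2::real}" and u: "u \<in> E"
    define j where "j = nat \<lfloor>(t - 1) / d\<rfloor>"
    have "(t - 1) / d \<le> 1 / d" using t d0 by (intro divide_right_mono) auto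
    then have jN: "j \<le> N" unfolding j_def N_def by (intro nat_mono floor_mono)
    have "real j \<le> (t - 1) / d" "(t - 1) / d < real j + 1"
      using t d0 by (auto simp: j_def) (linarith)?
    then have j: "real j * d \<le> t - 1" "t - 1 < real j * d + d"
      using d0 by (auto simp: field_simps)
    have "norm ((1 + real j * d) *\<^sub>R p - t *\<^sub>R u)
        = norm ((1 + real j * d - t) *\<^sub>R p + t *\<^sub>R (p - u))"
      by (simp add: algebra_simps)
    also have "\<dots> \<le> \<bar>1 + real j * d - t\<bar> * norm p + \<bar>t\<bar> * norm (p - u)"
      by (rule order_trans[OF norm_triangle_ineq]) simp
    also have "\<dots> \<le> d * 1 + 2 * d"
      using j t E(3)[OF u] normE[OF E(2)]
      by (intro add_mono mult_mono) (auto simp: dist_norm norm_minus_commute)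
    finally show "t *\<^sub>R u \<in> G"
      using jN by (auto simp: G_def dist_norm)
  next
    have "emeasure lborel G \<le> (\<Sum>j\<le>N. emeasure lborel (cball ((1 + real j * d) *\<^sub>R p) (3 * d)))"
      unfolding G_def by (rule emeasure_subadditive_finite) auto
    also have "\<dots> = ennreal (real (N + 1) * (?\<kappa> * (3 * d) ^ ?n))"
      using d by (simp add: emeasure_cball ennreal_mult ennreal_of_nat_eq_real_of_nat)
    also have "\<dots> \<le> ennreal (2 / d * (?\<kappa> * (3 * d) ^ ?n))"
    proof (intro ennreal_leI mult_right_mono)
      have "real N \<le> 1 / d" using d0 by (simp add: N_def)
      moreover have "1 \<le> 1 / d" using d d0 by simp
      ultimately show "real (N + 1) \<le> 2 / d" by simp
    qed (use d in auto)
    also have "2 / d * (?\<kappa> * (3 * d) ^ ?n) = 2 * 3 ^ ?n * ?\<kappa> * d ^ (?n - 1)"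
      using d0 by (simp add: power_mult_distrib field_simps flip: power_minus_mult[of ?n d])
    finally show "emeasure lborel G \<le> ennreal (2 * 3 ^ ?n * ?\<kappa> * d ^ (?n - 1))" .
  qed
qed

text \<open>A covering of the sphere of small total weight would yield a covering of the shell
  between the radii 1 and 2 by cones of small total volume, but the shell contains the ball
  \<open>B\<close>.\<close>

lemma hausdorff_outer_sphere_pos:
  assumes n: "DIM('a) \<ge> 2"
  shows "hausdorff_outer (DIM('a) - 1) (sphere 0 1 :: 'a::euclidean_space set) > 0"
proof (rule ccontr)
  let ?n = "DIM('a)" and ?S = "sphere 0 1 :: 'a set"
  let ?\<kappa> = "unit_ball_vol (real ?n)" and ?\<kappa>' = "unit_ball_vol (real (?n - 1))"
  assume "\<not> hausdorff_outer (?n - 1) ?S > 0"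
  moreover have "hausdorff_pre (?n - 1) 1 ?S \<le> hausdorff_outer (?n - 1) ?S"
    unfolding hausdorff_outer_def by (rule SUP_upper) simp
  ultimately have pre0: "hausdorff_pre (?n - 1) 1 ?S = 0" by simp
  \<comment> \<open>The ratio of the volume bound in \<open>cone_cover\<close> to the Hausdorff
    weight of a set of the same diameter.\<close>
  define C where "C = 2 * 3 ^ ?n * ?\<kappa> * 2 ^ (?n - 1) / ?\<kappa>'"
  have \<kappa>': "?\<kappa>' > 0" by simp
  have C: "C > 0" by (simp add: C_def)
  obtain b :: 'a where b: "b \<in> Basis" using nonempty_Basis by blast
  define B where "B = ball ((3/2) *\<^sub>R b) (1/2)"
  define v where "v = measure lborel B"
  have v: "v > 0" "emeasure lborel B = ennreal v"
    by (simp_all add: v_def B_def content_ball emeasure_ball)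
  \<comment> \<open>With this threshold the cones have total volume at most \<open>v / 2\<close>,
    less than the volume \<open>v\<close> of \<open>B\<close>. Scale 1 suffices, because cones are
    covered for every diameter up to 1.\<close>
  have "hausdorff_pre (?n - 1) 1 ?S < ennreal (v / (2 * C))"
    using pre0 v C by simp
  then obtain E where E: "?S \<subseteq> (\<Union>i. E i)" "\<And>i::nat. bounded (E i)" "\<And>i. diameter (E i) \<le> 1"
    and Ew: "(\<Sum>i. hausdorff_weight (?n - 1) (E i)) < ennreal (v / (2 * C))"
    unfolding hausdorff_pre_def INF_less_iff by auto
  have "\<exists>G. G \<in> sets borel \<and> (\<forall>t\<in>{1..2}. \<forall>u\<in>E i \<inter> ?S. t *\<^sub>R u \<in> G) \<and>
          emeasure lborel G \<le> ennreal C * hausdorff_weight (?n - 1) (E i)" for i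
  proof (cases "E i \<inter> ?S = {}")
    case False
    then obtain p where p: "p \<in> E i \<inter> ?S" by blast
    obtain G where G: "G \<in> sets borel" "\<And>t u. t \<in> {1..2} \<Longrightarrow> u \<in> E i \<inter> ?S \<Longrightarrow> t *\<^sub>R u \<in> G"
      "emeasure lborel G \<le> ennreal (2 * 3 ^ ?n * ?\<kappa> * diameter (E i) ^ (?n - 1))"
      by (rule cone_cover[OF n _ p, of "diameter (E i)"])
         (use diameter_bounded_bound[OF E(2)] diameter_ge_0[OF E(2)] E(3) p in auto)
    have *: "a * c ^ m = a * 2 ^ m / k * (k * (c / 2) ^ m)" if "k > 0" for a c k :: real and m
      using that by (simp add: power_divide)
    have "2 * 3 ^ ?n * ?\<kappa> * diameter (E i) ^ (?n - 1) = C * (?\<kappa>' * (diameter (E i) / 2) ^ (?n - 1))"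
      unfolding C_def by (rule *[OF \<kappa>'])
    also have "ennreal \<dots> = ennreal C * ennreal (?\<kappa>' * (diameter (E i) / 2) ^ (?n - 1))"
      using C by (intro ennreal_mult') simp
    also have "ennreal (?\<kappa>' * (diameter (E i) / 2) ^ (?n - 1)) = hausdorff_weight (?n - 1) (E i)"
      using p by (auto simp: hausdorff_weight_def)
    finally show ?thesis using G by metis
  qed (auto intro!: exI[of _ "{}"])
  then obtain G where G: "\<And>i. G i \<in> sets borel"
      "\<And>i t u. t \<in> {1..2} \<Longrightarrow> u \<in> E i \<inter> ?S \<Longrightarrow> t *\<^sub>R u \<in> G i"
      "\<And>i. emeasure lborel (G i) \<le> ennreal C * hausdorff_weight (?n - 1) (E i)"
    by metis
  have "B \<subseteq> (\<Union>i. G i)"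
  proof
    fix x assume "x \<in> B"
    then have "norm (x - (3/2) *\<^sub>R b) < 1/2" by (simp add: B_def dist_norm norm_minus_commute)
    moreover have "norm ((3/2) *\<^sub>R b) = 3/2" using b by simp
    ultimately have x: "1 \<le> norm x" "norm x \<le> 2"
      using norm_triangle_ineq2[of x "(3/2) *\<^sub>R b"] norm_triangle_ineq3[of x "(3/2) *\<^sub>R b"] by linarith+
    moreover have "norm x \<noteq> 0" using x(1) by linarith
    ultimately have "inverse (norm x) *\<^sub>R x \<in> ?S" by simp
    then obtain i where "inverse (norm x) *\<^sub>R x \<in> E i" using E(1) by blast
    then have "norm x *\<^sub>R (inverse (norm x) *\<^sub>R x) \<in> G i"
      using x \<open>inverse (norm x) *\<^sub>R x \<in> ?S\<close> by (intro G(2)) auto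
    moreover have "norm x \<noteq> 0" using x by linarith
    ultimately show "x \<in> (\<Union>i. G i)" by auto
  qed
  then have "ennreal v \<le> emeasure lborel (\<Union>i. G i)"
    unfolding v(2)[symmetric] by (rule emeasure_mono) (use G(1) in auto)
  also have "\<dots> \<le> (\<Sum>i. emeasure lborel (G i))"
    by (rule emeasure_subadditive_countably) (use G(1) in auto)
  also have "\<dots> \<le> (\<Sum>i. ennreal C * hausdorff_weight (?n - 1) (E i))"
    by (intro suminf_le G(3)) auto
  also have "\<dots> \<le> ennreal C * ennreal (v / (2 * C))"
    using Ew by (simp add: ennreal_suminf_cmult mult_left_mono less_imp_le)
  also have "\<dots> = ennreal (v / 2)"
    using C v by (simp flip: ennreal_mult)
  finally show False using v by simp
qed

section \<open>Isometry invariance and the constant c(n,r)\<close>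

lemma hausdorff_outer_isometry_le:
  fixes f :: "'a::metric_space \<Rightarrow> 'b::metric_space"
  assumes f: "\<And>x y. dist (f x) (f y) = dist x y"
  shows "hausdorff_outer s (f ` A) \<le> hausdorff_outer s A"
  unfolding hausdorff_outer_def
proof (intro SUP_mono')
  fix \<delta>
  have diam: "diameter (f ` E) = diameter E" for E
    by (simp add: diameter_def image_image f case_prod_unfold flip: map_prod_surj_on)
  show "hausdorff_pre s \<delta> (f ` A) \<le> hausdorff_pre s \<delta> A"
    unfolding hausdorff_pre_def[of s \<delta> A]
  proof (rule INF_greatest, clarify)
    fix E :: "nat \<Rightarrow> 'a set"
    assume E: "A \<subseteq> (\<Union>i. E i)" "\<forall>i. bounded (E i) \<and> diameter (E i) \<le> \<delta>"
    have "bounded (f ` E i)" for i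
    proof -
      obtain x e where "\<forall>y\<in>E i. dist x y \<le> e" using E(2) unfolding bounded_def by blast
      then have "\<forall>y\<in>f ` E i. dist (f x) y \<le> e" by (simp add: f)
      then show ?thesis unfolding bounded_def by blast
    qed
    then have "hausdorff_pre s \<delta> (f ` A) \<le> (\<Sum>i. hausdorff_weight s (f ` E i))"
      using E by (intro hausdorff_pre_le) (force simp: diam)+
    then show "hausdorff_pre s \<delta> (f ` A) \<le> (\<Sum>i. hausdorff_weight s (E i))"
      by (simp add: hausdorff_weight_def diam cong: if_cong)
  qed
qed

lemma distr_hausdorff_measure_isometry:
  fixes f :: "'a::metric_space \<Rightarrow> 'a"
  assumes f: "\<And>x y. dist (f x) (f y) = dist x y" and "surj f"
  shows "distr (hausdorff_measure s) borel f = hausdorff_measure s"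
proof (rule measure_eqI)
  have "inj f" by (rule injI) (metis f dist_eq_0_iff)
  then have g: "dist (inv f x) (inv f y) = dist x y" for x y
    using f[of "inv f x" "inv f y"] \<open>surj f\<close> by (simp add: surj_f_inv_f)
  have "continuous_on UNIV f"
    unfolding continuous_on_iff using f by auto
  then have m: "f \<in> borel_measurable borel" by (rule borel_measurable_continuous_onI)
  fix A assume "A \<in> sets (distr (hausdorff_measure s) borel f)"
  then have A: "A \<in> sets borel" by simp
  have "hausdorff_outer s (f -` A) = hausdorff_outer s A"
  proof (rule antisym)
    have "f -` A = inv f ` A"
      by (simp add: bij_vimage_eq_inv_image bij_def \<open>inj f\<close> \<open>surj f\<close>)
    then show "hausdorff_outer s (f -` A) \<le> hausdorff_outer s A"
      using hausdorff_outer_isometry_le[of "inv f" s A] g by simp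
    show "hausdorff_outer s A \<le> hausdorff_outer s (f -` A)"
      using hausdorff_outer_isometry_le[of f s "f -` A"] f \<open>surj f\<close> by simp
  qed
  then show "emeasure (distr (hausdorff_measure s) borel f) A = emeasure (hausdorff_measure s) A"
    using A m measurable_sets[OF m A]
    by (subst emeasure_distr) (auto simp: emeasure_hausdorff_measure cong: measurable_cong_sets)
qed simp

text \<open>An orthogonal map that takes \<open>a\<close> to \<open>b\<close> preserves the sphere
  and, being a surjective isometry, the Hausdorff measure; substituting it turns
  \<open>b \<bullet> f u\<close> into \<open>a \<bullet> u\<close>.\<close>

lemma nn_integral_sphere_rotate:
  fixes a b :: "real ^ 'n"
  assumes n: "CARD('n) \<ge> 2" and "norm a = 1" "norm b = 1"
    and [measurable]: "g \<in> borel_measurable borel"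
  shows "(\<integral>\<^sup>+u\<in>sphere 0 1. g (a \<bullet> u) \<partial>hausdorff_measure s) = (\<integral>\<^sup>+u\<in>sphere 0 1. g (b \<bullet> u) \<partial>hausdorff_measure s)"
proof -
  obtain f where f: "orthogonal_transformation f" "f a = b"
    using rotation_exists_1[OF n assms(2,3)] by metis
  note lin = orthogonal_transformation_linear[OF f(1)]
  have d: "dist (f x) (f y) = dist x y" for x y
    using orthogonal_transformation_norm[OF f(1), of "x - y"] linear_diff[OF lin] by (simp add: dist_norm)
  have m [measurable]: "f \<in> borel_measurable borel"
    by (intro borel_measurable_continuous_onI linear_continuous_on lin[unfolded linear_conv_bounded_linear])
  have "(\<integral>\<^sup>+u\<in>sphere 0 1. g (b \<bullet> u) \<partial>hausdorff_measure s)
      = (\<integral>\<^sup>+u\<in>sphere 0 1. g (b \<bullet> u) \<partial>distr (hausdorff_measure s) borel f)"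
    using d orthogonal_transformation_surj[OF f(1)] by (simp add: distr_hausdorff_measure_isometry)
  also have "\<dots> = (\<integral>\<^sup>+u. g (b \<bullet> f u) * indicator (sphere 0 1) (f u) \<partial>hausdorff_measure s)"
    by (rule nn_integral_distr) measurable
  also have "\<dots> = (\<integral>\<^sup>+u\<in>sphere 0 1. g (a \<bullet> u) \<partial>hausdorff_measure s)"
    using f by (intro nn_integral_cong)
       (auto simp: orthogonal_transformation_def orthogonal_transformation_norm[OF f(1)] indicator_def)
  finally show ?thesis ..
qed

text \<open>\<open>sphere_const\<close> is a Bochner integral, so integrability must be secured: the
  integrand is at most 1 on a sphere of finite measure.\<close>

lemma sphere_const_eq:
  fixes e :: "'a::euclidean_space"
  assumes "norm e = 1" "r > 0"
  shows "ennreal (sphere_const e r)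
       = (\<integral>\<^sup>+u\<in>sphere 0 1. ennreal ((max (e \<bullet> u) 0) powr r) \<partial>hausdorff_measure (DIM('a) - 1))"
proof -
  let ?H = "hausdorff_measure (DIM('a) - 1) :: 'a measure"
  have "sphere (0::'a) 1 \<in> sets borel" by (simp add: borel_closed)
  then have "integrable ?H (indicator (sphere (0::'a) 1) :: 'a \<Rightarrow> real)"
    using hausdorff_outer_sphere_finite[where 'a='a]
    by (simp add: integrable_real_indicator emeasure_hausdorff_measure)
  then have int: "integrable ?H (\<lambda>u. indicator (sphere 0 1) u * (max (e \<bullet> u) 0) powr r)"
  proof (rule Bochner_Integration.integrable_bound)
    show "(\<lambda>u. indicator (sphere 0 1) u * (max (e \<bullet> u) 0) powr r) \<in> borel_measurable ?H"
      by measurable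
    show "AE u in ?H. norm (indicator (sphere 0 1) u * (max (e \<bullet> u) 0) powr r) \<le> norm (indicator (sphere 0 1) u :: real)"
    proof (rule AE_I2)
      fix u
      have "max (e \<bullet> u) 0 powr r \<le> 1" if "norm u = 1"
        using norm_cauchy_schwarz[of e u] assms that by (intro powr_le1) auto
      then show "norm (indicator (sphere 0 1) u * (max (e \<bullet> u) 0) powr r) \<le> norm (indicator (sphere 0 1) u :: real)"
        by (auto simp: indicator_def)
    qed
  qed
  have "(\<integral>\<^sup>+u. ennreal (indicator (sphere 0 1) u * (max (e \<bullet> u) 0) powr r) \<partial>?H)
      = ennreal (\<integral>u. indicator (sphere 0 1) u * (max (e \<bullet> u) 0) powr r \<partial>?H)"
    by (rule nn_integral_eq_integral[OF int]) auto
  then show ?thesis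
    by (simp add: sphere_const_def set_lebesgue_integral_def ennreal_mult' ennreal_indicator mult.commute)
qed

text \<open>If the constant vanished, rotation invariance would give \<open>a \<bullet> u \<le> 0\<close> for almost all \<open>u\<close> in the
  sphere and every unit vector \<open>a\<close>, hence \<open>u = 0\<close> almost everywhere on the sphere.\<close>

lemma sphere_const_pos:
  fixes e :: "real ^ 'n"
  assumes n: "CARD('n) \<ge> 2" and e: "norm e = 1" and r: "r > 0"
  shows "sphere_const e r > 0"
proof (rule ccontr)
  let ?H = "hausdorff_measure (DIM(real ^ 'n) - 1) :: (real ^ 'n) measure"
  let ?S = "sphere 0 1 :: (real ^ 'n) set"
  assume "\<not> sphere_const e r > 0"
  then have "(\<integral>\<^sup>+u\<in>?S. ennreal ((max (e \<bullet> u) 0) powr r) \<partial>?H) = 0"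
    using sphere_const_eq[OF e r] by (simp add: ennreal_neg not_less)
  then have zero: "(\<integral>\<^sup>+u\<in>?S. ennreal ((max (a \<bullet> u) 0) powr r) \<partial>?H) = 0" if "norm a = 1" for a
    using nn_integral_sphere_rotate[OF n that e, of "\<lambda>x. ennreal ((max x 0) powr r)"] by simp
  have neg: "AE u in ?H. u \<in> ?S \<longrightarrow> a \<bullet> u \<le> 0" if "norm a = 1" for a
  proof -
    have "AE u in ?H. ennreal ((max (a \<bullet> u) 0) powr r) * indicator ?S u = 0"
      using zero[OF that] by (subst (asm) nn_integral_0_iff_AE) auto
    then show ?thesis
      by eventually_elim (auto simp: indicator_def split: if_splits)
  qed
  have "AE u in ?H. \<forall>b\<in>Basis. u \<in> ?S \<longrightarrow> b \<bullet> u = 0"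
  proof (rule AE_finite_allI)
    fix b :: "real ^ 'n" assume b: "b \<in> Basis"
    have "AE u in ?H. u \<in> ?S \<longrightarrow> b \<bullet> u \<le> 0" "AE u in ?H. u \<in> ?S \<longrightarrow> (- b) \<bullet> u \<le> 0"
      using b by (intro neg; simp)+
    then show "AE u in ?H. u \<in> ?S \<longrightarrow> b \<bullet> u = 0"
      by eventually_elim auto
  qed simp
  then have "AE u in ?H. u \<notin> ?S"
    by eventually_elim (auto simp: euclidean_all_zero_iff inner_commute)
  then have "emeasure ?H ?S = 0"
    by (subst (asm) AE_iff_measurable[where N="?S"]) auto
  then show False
    using hausdorff_outer_sphere_pos[where 'a="real ^ 'n"] n
    by (simp add: emeasure_hausdorff_measure borel_closed)
qed

section \<open>The intensity measure\<close>

lemma hyperplane_eq_iff: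
  assumes u: "u \<in> sphere 0 1" and v: "v \<in> sphere 0 1"
  shows "hyperplane u t = hyperplane v s \<longleftrightarrow> (u, t) = (v, s) \<or> (u, t) = (- v, - s)"
proof
  have uu: "u \<bullet> u = 1" and vv: "v \<bullet> v = 1" using u v by (simp_all add: norm_eq_1)
  assume eq: "hyperplane u t = hyperplane v s"
  have "t *\<^sub>R u \<in> hyperplane u t" by (simp add: hyperplane_def uu)
  then have s: "t * (u \<bullet> v) = s" unfolding eq by (simp add: hyperplane_def)
  \<comment> \<open>The part of \<open>v\<close> orthogonal to \<open>u\<close>. Translation by it
    keeps \<open>t *\<^sub>R u\<close> in the hyperplane, which forces it to be orthogonal to
    \<open>v\<close> too, hence to vanish.\<close>
  define w where "w = v - (u \<bullet> v) *\<^sub>R u"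
  have wu: "w \<bullet> u = 0" by (simp add: w_def inner_diff_left inner_commute[of v u] uu)
  then have "t *\<^sub>R u + w \<in> hyperplane u t" by (simp add: hyperplane_def uu inner_add_left)
  then have "w \<bullet> v = 0" unfolding eq using s by (simp add: hyperplane_def inner_add_left)
  then have "w \<bullet> w = 0" using wu by (simp add: w_def inner_diff_right)
  then have v_eq: "v = (u \<bullet> v) *\<^sub>R u" by (simp add: w_def)
  then have "\<bar>u \<bullet> v\<bar> = 1" using u v by (metis mem_sphere_0 mult.right_neutral norm_scaleR)
  then consider "u \<bullet> v = 1" | "u \<bullet> v = -1" by linarith
  then show "(u, t) = (v, s) \<or> (u, t) = (- v, - s)"
    by cases (use v_eq s in auto)
qed (auto simp: hyperplane_def)

text \<open>Describes sets of hyperplanes by parameter sets that need not be symmetric under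
  \<open>(u, t) \<mapsto> (- u, - t)\<close>. For open \<open>W\<close> the image is open in the
  quotient topology, as its full preimage in the parameter space is the trace of \<open>W\<close>
  and its reflection.\<close>

definition hyperplane_image :: "('a::euclidean_space \<times> real) set \<Rightarrow> 'a set set" where
  "hyperplane_image W = {hyperplane u t | u t. u \<in> sphere 0 1 \<and> (u, t) \<in> W}"

lemma hyperplane_in_image_iff:
  assumes "u \<in> sphere 0 1"
  shows "hyperplane u t \<in> hyperplane_image W \<longleftrightarrow> (u, t) \<in> W \<or> (- u, - t) \<in> W"
proof
  assume "hyperplane u t \<in> hyperplane_image W"
  then obtain v s where "v \<in> sphere 0 1" "(v, s) \<in> W" "hyperplane u t = hyperplane v s"
    by (auto simp: hyperplane_image_def)
  then show "(u, t) \<in> W \<or> (- u, - t) \<in> W"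
    using hyperplane_eq_iff[OF assms, of v t s] by auto
next
  have *: "hyperplane v s \<in> hyperplane_image W" if "v \<in> sphere 0 1" "(v, s) \<in> W" for v s
    using that by (auto simp: hyperplane_image_def)
  have "hyperplane u t = hyperplane (- u) (- t)" by (auto simp: hyperplane_def)
  then show "hyperplane u t \<in> hyperplane_image W" if "(u, t) \<in> W \<or> (- u, - t) \<in> W"
    using that assms *[of u t] *[of "- u" "- t"] by auto
qed

lemma space_hyperplane_borel [simp]: "space hyperplane_borel = hyperplanes"
  unfolding hyperplane_borel_def
  by (rule space_measure_of) (auto simp: openin_hyperplane_topology)

lemma openin_in_hyperplane_borel: "openin hyperplane_topology U \<Longrightarrow> U \<in> sets hyperplane_borel"
  unfolding hyperplane_borel_def
  by (subst sets_measure_of) (auto simp: openin_hyperplane_topology)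

lemma hyperplane_image_sets [measurable, simp]:
  fixes W :: "('a::euclidean_space \<times> real) set"
  assumes "open W"
  shows "hyperplane_image W \<in> sets hyperplane_borel"
proof (rule openin_in_hyperplane_borel, unfold openin_hyperplane_topology, intro conjI)
  show "hyperplane_image W \<subseteq> hyperplanes"
    by (auto simp: hyperplane_image_def hyperplanes_def)
  have "{p \<in> sphere 0 1 \<times> UNIV. case_prod hyperplane p \<in> hyperplane_image W}
      = (sphere 0 1 \<times> UNIV) \<inter> (W \<union> uminus -` W)"
    by (auto simp: hyperplane_in_image_iff)
  moreover have "open (uminus -` W)"
    by (intro open_vimage assms continuous_intros)
  ultimately show "openin (top_of_set (sphere 0 1 \<times> UNIV))
      {p \<in> sphere 0 1 \<times> UNIV. case_prod hyperplane p \<in> hyperplane_image W}"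
    using assms by (simp add: openin_open_Int open_Un)
qed

definition hyperplane_param :: "'a::euclidean_space set set \<Rightarrow> ('a \<times> real) set" where
  "hyperplane_param B = {(u, t). u \<in> sphere 0 1 \<and> hyperplane u t \<in> B}"

text \<open>The parametrisation is continuous for the quotient topology, hence Borel on its domain;
  the domain is closed, so relatively Borel subsets of it are Borel.\<close>

lemma hyperplane_param_sets [measurable]:
  fixes B :: "'a::euclidean_space set set"
  assumes "B \<in> sets hyperplane_borel"
  shows "hyperplane_param B \<in> sets borel"
proof -
  let ?S = "sphere (0::'a) 1 \<times> (UNIV :: real set)"
  have S: "?S \<in> sets borel" by (intro borel_closed closed_Times closed_sphere closed_UNIV)
  have "case_prod hyperplane \<in> measurable (restrict_space borel ?S) (hyperplane_borel :: 'a set measure)"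
    unfolding hyperplane_borel_def
  proof (rule measurable_measure_of)
    fix U :: "'a set set" assume "U \<in> {U. openin hyperplane_topology U}"
    then obtain T where T: "open T" "{p \<in> ?S. case_prod hyperplane p \<in> U} = ?S \<inter> T"
      unfolding mem_Collect_eq openin_hyperplane_topology openin_open by blast
    have "case_prod hyperplane -` U \<inter> space (restrict_space borel ?S) = ?S \<inter> T"
      unfolding T(2)[symmetric] by (auto simp: space_restrict_space)
    then show "case_prod hyperplane -` U \<inter> space (restrict_space borel ?S) \<in> sets (restrict_space borel ?S)"
      using T(1) by (auto simp: sets_restrict_space)
  qed (auto simp: openin_hyperplane_topology space_restrict_space hyperplanes_def)
  from measurable_sets[OF this assms]
  have "case_prod hyperplane -` B \<inter> ?S \<in> sets (restrict_space borel ?S)"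
    by (simp add: space_restrict_space)
  then have "case_prod hyperplane -` B \<inter> ?S \<in> sets borel"
    using S by (simp add: sets_restrict_space_iff)
  also have "case_prod hyperplane -` B \<inter> ?S = hyperplane_param B"
    by (auto simp: hyperplane_param_def)
  finally show ?thesis .
qed

section \<open>The intensity as a measure\<close>

lemma sets_hyperplane_intensity [simp]:
  "sets (hyperplane_intensity \<gamma> r :: 'a::euclidean_space set measure) = sets hyperplane_borel"
  unfolding hyperplane_intensity_def
  using sets.sigma_sets_eq[of "hyperplane_borel :: 'a set measure"]
    sets.space_closed[of "hyperplane_borel :: 'a set measure"] by simp

text \<open>Countable additivity comes from exchanging the sum with both integrals. This needs joint
  measurability in \<open>(u, t)\<close>, hence the rewriting by
  \<open>hyperplane_param\<close>.\<close>

lemma emeasure_hyperplane_intensity: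
  fixes B :: "'a::euclidean_space set set"
  assumes "B \<in> sets hyperplane_borel"
  shows "emeasure (hyperplane_intensity \<gamma> r) B
    = ennreal (2 * \<gamma> / (real DIM('a) * unit_ball_vol (real DIM('a)))) *
        (\<integral>\<^sup>+u\<in>sphere (0::'a) 1.
           (\<integral>\<^sup>+t\<in>{0..}. indicator B (hyperplane u t) * ennreal (t powr (r - 1)) \<partial>lborel)
         \<partial>hausdorff_measure (DIM('a) - 1))" (is "_ = ?\<mu> B")
proof (rule emeasure_measure_of[OF hyperplane_intensity_def])
  let ?H = "hausdorff_measure (DIM('a) - 1) :: 'a measure"
  define w where "w t = indicator {0..} t * ennreal (t powr (r - 1))" for t :: real
  have [measurable]: "w \<in> borel_measurable borel" unfolding w_def by measurable
  define c where "c = ennreal (2 * \<gamma> / (real DIM('a) * unit_ball_vol (real DIM('a))))"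
  have \<mu>: "?\<mu> B = c * (\<integral>\<^sup>+u. \<integral>\<^sup>+t. indicator (hyperplane_param B) (u, t) * w t \<partial>lborel \<partial>?H)" for B
    unfolding c_def
    by (intro arg_cong2[where f="(*)"] nn_integral_cong refl)
       (auto simp: hyperplane_param_def w_def indicator_def intro!: nn_integral_cong)
  show "positive (sets (hyperplane_intensity \<gamma> r)) ?\<mu>"
    by (simp add: positive_def)
  show "countably_additive (sets (hyperplane_intensity \<gamma> r)) ?\<mu>"
  proof (rule countably_additiveI)
    fix A :: "nat \<Rightarrow> 'a set set"
    assume A: "range A \<subseteq> sets (hyperplane_intensity \<gamma> r)" "disjoint_family A"
    have "hyperplane_param (A i) \<in> sets borel" for i
      using A(1) by (intro hyperplane_param_sets) auto
    then have [measurable]: "hyperplane_param (A i) \<in> sets (borel \<Otimes>\<^sub>M borel)" for i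
      by (simp only: borel_prod)
    have "(\<Sum>i. ?\<mu> (A i)) = c * (\<Sum>i. \<integral>\<^sup>+u. \<integral>\<^sup>+t. indicator (hyperplane_param (A i)) (u, t) * w t \<partial>lborel \<partial>?H)"
      unfolding \<mu> by (rule ennreal_suminf_cmult)
    also have "(\<Sum>i. \<integral>\<^sup>+u. \<integral>\<^sup>+t. indicator (hyperplane_param (A i)) (u, t) * w t \<partial>lborel \<partial>?H)
        = (\<integral>\<^sup>+u. (\<Sum>i. \<integral>\<^sup>+t. indicator (hyperplane_param (A i)) (u, t) * w t \<partial>lborel) \<partial>?H)"
      by (rule nn_integral_suminf[symmetric]) measurable
    also have "\<dots> = (\<integral>\<^sup>+u. \<integral>\<^sup>+t. (\<Sum>i. indicator (hyperplane_param (A i)) (u, t) * w t) \<partial>lborel \<partial>?H)"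
      by (intro nn_integral_cong nn_integral_suminf[symmetric]) measurable
    also have "\<dots> = (\<integral>\<^sup>+u. \<integral>\<^sup>+t. indicator (hyperplane_param (\<Union>i. A i)) (u, t) * w t \<partial>lborel \<partial>?H)"
    proof (intro nn_integral_cong)
      fix u t
      have "disjoint_family (\<lambda>i. hyperplane_param (A i))"
        using A(2) unfolding disjoint_family_on_def hyperplane_param_def by blast
      then have "(\<Sum>i. indicator (hyperplane_param (A i)) (u, t) :: ennreal)
          = indicator (\<Union>i. hyperplane_param (A i)) (u, t)"
        by (rule suminf_indicator)
      also have "(\<Union>i. hyperplane_param (A i)) = hyperplane_param (\<Union>i. A i)"
        by (auto simp: hyperplane_param_def)
      finally show "(\<Sum>i. indicator (hyperplane_param (A i)) (u, t) * w t)
          = indicator (hyperplane_param (\<Union>i. A i)) (u, t) * w t"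
        by (simp add: ennreal_suminf_multc)
    qed
    finally show "(\<Sum>i. ?\<mu> (A i)) = ?\<mu> (\<Union>i. A i)"
      unfolding \<mu> .
  qed
qed (use assms sets.space_closed[of hyperplane_borel] in auto)

section \<open>The intensity of separating hyperplanes\<close>

lemma nn_integral_powr_from_0:
  assumes "r > 0" "a \<ge> 0"
  shows "(\<integral>\<^sup>+t\<in>{0..<a}. ennreal (t powr (r - 1)) \<partial>lborel) = ennreal (a powr r / r)"
proof -
  have "((\<lambda>t. t powr (r - 1)) has_integral (a powr r / r)) {0..a}"
    using has_integral_powr_from_0[of "r - 1" a] assms by simp
  then have "((\<lambda>t. if t \<in> {0..a} then t powr (r - 1) else 0) has_integral (a powr r / r)) UNIV"
    by (simp only: has_integral_restrict_UNIV)
  then have "(\<integral>\<^sup>+t. ennreal (if t \<in> {0..a} then t powr (r - 1) else 0) \<partial>lborel) = ennreal (a powr r / r)"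
    by (intro nn_integral_has_integral_lborel) auto
  moreover have "(\<integral>\<^sup>+t\<in>{0..<a}. ennreal (t powr (r - 1)) \<partial>lborel)
      = (\<integral>\<^sup>+t. ennreal (if t \<in> {0..a} then t powr (r - 1) else 0) \<partial>lborel)"
    using AE_lborel_singleton[of a] by (intro nn_integral_cong_AE) (auto simp: indicator_def elim!: eventually_mono)
  ultimately show ?thesis by simp
qed

text \<open>The set A_x of the overview. \<open>t < x \<bullet> u\<close> is the negation of
  membership of \<open>x\<close> in the closed half-space, and the strict inequalities make the
  parameter set open, hence the family measurable.\<close>

definition separating :: "'a::euclidean_space \<Rightarrow> 'a set set" where
  "separating x = hyperplane_image {(u, t). 0 < t \<and> t < x \<bullet> u}"

lemma separating_sets [measurable, simp]: "separating x \<in> sets hyperplane_borel"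
proof -
  have "open {p :: 'a \<times> real. 0 < snd p \<and> snd p < x \<bullet> fst p}"
    by (intro open_Collect_conj open_Collect_less continuous_intros)
  then show ?thesis
    unfolding separating_def by (intro hyperplane_image_sets) (simp add: case_prod_unfold)
qed

text \<open>In each direction the radial integral is the \<open>r\<close>-th power of the positive
  part of \<open>x \<bullet> u\<close>, divided by \<open>r\<close>. Homogeneity takes out
  \<open>norm x powr r\<close>, and rotation invariance replaces the direction of \<open>x\<close>
  by \<open>e\<close>.\<close>

lemma emeasure_separating:
  fixes e x :: "real ^ 'n"
  assumes n: "CARD('n) \<ge> 2" and \<gamma>: "\<gamma> > 0" and r: "r > 0" and e: "norm e = 1"
  shows "emeasure (hyperplane_intensity \<gamma> r) (separating x)
       = ennreal (2 * \<gamma> * sphere_const e r / (real CARD('n) * unit_ball_vol (real CARD('n)) * r) * norm x powr r)"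
proof -
  let ?H = "hausdorff_measure (DIM(real ^ 'n) - 1) :: (real ^ 'n) measure"
  have inner: "(\<integral>\<^sup>+t\<in>{0..}. indicator (separating x) (hyperplane u t) * ennreal (t powr (r - 1)) \<partial>lborel)
      = ennreal ((max (x \<bullet> u) 0) powr r / r)" if u: "u \<in> sphere 0 1" for u
  proof -
    have "(\<integral>\<^sup>+t\<in>{0..}. indicator (separating x) (hyperplane u t) * ennreal (t powr (r - 1)) \<partial>lborel)
        = (\<integral>\<^sup>+t\<in>{0..<max (x \<bullet> u) 0}. ennreal (t powr (r - 1)) \<partial>lborel)"
    proof (rule nn_integral_cong)
      fix t :: real
      \<comment> \<open>At \<open>t = 0\<close> the two indicators may differ, but there the weight
        is 0 by the convention \<open>0 powr y = 0\<close>.\<close>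
      show "indicator (separating x) (hyperplane u t) * ennreal (t powr (r - 1)) * indicator {0..} t
          = ennreal (t powr (r - 1)) * indicator {0..<max (x \<bullet> u) 0} t"
        using u by (cases "t = 0") (auto simp: separating_def hyperplane_in_image_iff indicator_def)
    qed
    also have "\<dots> = ennreal ((max (x \<bullet> u) 0) powr r / r)"
      by (rule nn_integral_powr_from_0) (use r in auto)
    finally show ?thesis .
  qed
  have nn: "(\<integral>\<^sup>+u\<in>sphere 0 1. (\<integral>\<^sup>+t\<in>{0..}. indicator (separating x) (hyperplane u t) * ennreal (t powr (r - 1)) \<partial>lborel) \<partial>?H)
      = (\<integral>\<^sup>+u\<in>sphere 0 1. ennreal ((max (x \<bullet> u) 0) powr r / r) \<partial>?H)" (is "(\<integral>\<^sup>+u\<in>_. ?f u \<partial>_) = (\<integral>\<^sup>+u\<in>_. ?g u \<partial>_)")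
  proof (rule nn_integral_cong)
    fix u
    show "?f u * indicator (sphere 0 1) u = ?g u * indicator (sphere 0 1) u"
      by (cases "u \<in> sphere 0 1") (simp_all only: inner indicator_simps mult_zero_right simp_thms)
  qed
  have "emeasure (hyperplane_intensity \<gamma> r) (separating x)
      = ennreal (2 * \<gamma> / (real CARD('n) * unit_ball_vol (real CARD('n)))) *
          (\<integral>\<^sup>+u\<in>sphere 0 1. ennreal ((max (x \<bullet> u) 0) powr r / r) \<partial>?H)"
    unfolding emeasure_hyperplane_intensity[OF separating_sets] nn
    by simp
  also have "(\<integral>\<^sup>+u\<in>sphere 0 1. ennreal ((max (x \<bullet> u) 0) powr r / r) \<partial>?H)
      = ennreal (norm x powr r / r * sphere_const e r)"
  proof (cases "x = 0")
    case False
    define a where "a = x /\<^sub>R norm x"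
    have a: "norm a = 1" "x = norm x *\<^sub>R a" using False by (simp_all add: a_def)
    have "(\<integral>\<^sup>+u\<in>sphere 0 1. ennreal ((max (x \<bullet> u) 0) powr r / r) \<partial>?H)
        = (\<integral>\<^sup>+u. ennreal (norm x powr r / r) * (ennreal ((max (a \<bullet> u) 0) powr r) * indicator (sphere 0 1) u) \<partial>?H)"
    proof (rule nn_integral_cong)
      fix u
      have "max (x \<bullet> u) 0 = norm x * max (a \<bullet> u) 0"
        by (subst a(2)) (simp add: max_mult_distrib_left del: a_def)
      then have "(max (x \<bullet> u) 0) powr r / r = norm x powr r / r * (max (a \<bullet> u) 0) powr r"
        by (simp add: powr_mult)
      moreover have "0 \<le> norm x powr r / r" using r by simp
      ultimately have "ennreal ((max (x \<bullet> u) 0) powr r / r)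
          = ennreal (norm x powr r / r) * ennreal ((max (a \<bullet> u) 0) powr r)"
        by (simp only: ennreal_mult')
      then show "ennreal ((max (x \<bullet> u) 0) powr r / r) * indicator (sphere 0 1) u
          = ennreal (norm x powr r / r) * (ennreal ((max (a \<bullet> u) 0) powr r) * indicator (sphere 0 1) u)"
        by (simp only: mult.assoc)
    qed
    also have "\<dots> = ennreal (norm x powr r / r) * (\<integral>\<^sup>+u\<in>sphere 0 1. ennreal ((max (a \<bullet> u) 0) powr r) \<partial>?H)"
      by (rule nn_integral_cmult) measurable
    also have "(\<integral>\<^sup>+u\<in>sphere 0 1. ennreal ((max (a \<bullet> u) 0) powr r) \<partial>?H) = ennreal (sphere_const e r)"
      unfolding sphere_const_eq[OF e r]
      by (rule nn_integral_sphere_rotate[OF n a(1) e, of "\<lambda>x. ennreal ((max x 0) powr r)"]) measurable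
    finally show ?thesis
      using r sphere_const_pos[OF n e r] by (subst ennreal_mult) auto
  qed simp
  finally show ?thesis
    using \<gamma> r sphere_const_pos[OF n e r] by (simp flip: ennreal_mult add: field_simps)
qed

section \<open>Null and locally finite families of hyperplanes\<close>

lemma hyperplanes_through_0_sets: "{H \<in> hyperplanes. 0 \<in> H} \<in> sets hyperplane_borel"
proof -
  have "open {p :: 'a::euclidean_space \<times> real. snd p \<noteq> 0}"
    by (intro open_Collect_neq continuous_intros)
  then have "hyperplane_image {p :: 'a \<times> real. snd p \<noteq> 0} \<in> sets hyperplane_borel"
    by simp
  then have "hyperplanes - hyperplane_image {p :: 'a \<times> real. snd p \<noteq> 0} \<in> sets hyperplane_borel"
    using sets.compl_sets by fastforce
  also have "hyperplanes - hyperplane_image {p :: 'a \<times> real. snd p \<noteq> 0} = {H \<in> hyperplanes. 0 \<in> H}"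
    by (auto simp: hyperplanes_def hyperplane_in_image_iff) (auto simp: hyperplane_def)
  finally show ?thesis .
qed

lemma emeasure_hyperplanes_through_0:
  "emeasure (hyperplane_intensity \<gamma> r) {H \<in> hyperplanes. 0 \<in> H} = 0"
proof -
  \<comment> \<open>Only \<open>t = 0\<close> gives a hyperplane through the origin, and
    \<open>0 powr (r - 1)\<close> is 0 by convention, so the integrand vanishes pointwise.\<close>
  have *: "indicator {H \<in> hyperplanes. 0 \<in> H} (hyperplane u t) * ennreal (t powr (r - 1)) = 0" for u :: 'a and t
    by (cases "t = 0") (auto simp: hyperplane_def indicator_def)
  then show ?thesis
    unfolding emeasure_hyperplane_intensity[OF hyperplanes_through_0_sets] * by simp
qed

text \<open>The hyperplanes that meet the open ball of radius \<open>R\<close> about the origin.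
  They localise the process: finite intensity, and every \<open>separating x\<close> with
  \<open>norm x < R\<close> lies among them.\<close>

definition near_hyperplanes :: "real \<Rightarrow> 'a::euclidean_space set set" where
  "near_hyperplanes R = hyperplane_image {(u, t). \<bar>t\<bar> < R}"

lemma near_hyperplanes_sets [measurable, simp]: "near_hyperplanes R \<in> sets hyperplane_borel"
proof -
  have "open {p :: 'a \<times> real. \<bar>snd p\<bar> < R}"
    by (intro open_Collect_less continuous_intros)
  then show ?thesis
    unfolding near_hyperplanes_def by (intro hyperplane_image_sets) (simp add: case_prod_unfold)
qed

lemma emeasure_near_hyperplanes_finite:
  assumes r: "r > 0" and R: "R \<ge> 0"
  shows "emeasure (hyperplane_intensity \<gamma> r) (near_hyperplanes R :: 'a::euclidean_space set set) < \<infinity>"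
proof -
  let ?H = "hausdorff_measure (DIM('a) - 1) :: 'a measure"
  have inner: "(\<integral>\<^sup>+t\<in>{0..}. indicator (near_hyperplanes R) (hyperplane u t) * ennreal (t powr (r - 1)) \<partial>lborel)
      = ennreal (R powr r / r)" if u: "u \<in> sphere 0 1" for u :: 'a
  proof -
    have "(\<integral>\<^sup>+t\<in>{0..}. indicator (near_hyperplanes R) (hyperplane u t) * ennreal (t powr (r - 1)) \<partial>lborel)
        = (\<integral>\<^sup>+t\<in>{0..<R}. ennreal (t powr (r - 1)) \<partial>lborel)"
      by (rule nn_integral_cong)
         (use u in \<open>auto simp: near_hyperplanes_def hyperplane_in_image_iff indicator_def\<close>)
    also have "\<dots> = ennreal (R powr r / r)"
      by (rule nn_integral_powr_from_0[OF r R])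
    finally show ?thesis .
  qed
  have nn: "(\<integral>\<^sup>+u\<in>sphere 0 1. (\<integral>\<^sup>+t\<in>{0..}. indicator (near_hyperplanes R) (hyperplane u t) * ennreal (t powr (r - 1)) \<partial>lborel) \<partial>?H)
      = (\<integral>\<^sup>+u\<in>sphere 0 1. ennreal (R powr r / r) \<partial>?H)" (is "(\<integral>\<^sup>+u\<in>_. ?f u \<partial>_) = (\<integral>\<^sup>+u\<in>_. ?g u \<partial>_)")
  proof (rule nn_integral_cong)
    fix u
    show "?f u * indicator (sphere 0 1) u = ?g u * indicator (sphere 0 1) u"
      by (cases "u \<in> sphere 0 1") (simp_all only: inner indicator_simps mult_zero_right simp_thms)
  qed
  have "emeasure (hyperplane_intensity \<gamma> r) (near_hyperplanes R :: 'a set set)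
      = ennreal (2 * \<gamma> / (real DIM('a) * unit_ball_vol (real DIM('a)))) *
          (\<integral>\<^sup>+u\<in>sphere 0 1. ennreal (R powr r / r) \<partial>?H)"
    unfolding emeasure_hyperplane_intensity[OF near_hyperplanes_sets] nn
    by simp
  also have "(\<integral>\<^sup>+u\<in>sphere 0 1. ennreal (R powr r / r) \<partial>?H)
      = ennreal (R powr r / r) * hausdorff_outer (DIM('a) - 1) (sphere (0::'a) 1)"
    by (simp add: nn_integral_cmult_indicator emeasure_hausdorff_measure)
  finally show ?thesis
    using hausdorff_outer_sphere_finite[where 'a='a] by (simp add: ennreal_mult_less_top)
qed

section \<open>The zero cell of a hyperplane process\<close>

text \<open>A set of minimal positive measure is met by every measurable set either almost entirely or
  almost not at all; cutting it down by a countable separating family leaves a single point.\<close>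

lemma integer_valued_measure_atom:
  assumes vals: "\<And>B. B \<in> sets M \<Longrightarrow> emeasure M B \<in> range ennreal_of_enat"
    and A: "A \<in> sets M" "emeasure M A > 0" "emeasure M A < \<infinity>"
    and \<G>: "countable \<G>" "\<G> \<subseteq> sets M"
    and sep: "\<And>H H'. H \<in> A \<Longrightarrow> H' \<in> A \<Longrightarrow> H \<noteq> H' \<Longrightarrow> \<exists>G\<in>\<G>. H \<in> G \<and> H' \<notin> G"
  obtains H where "H \<in> A" "emeasure M {H} > 0"
proof -
  have nat_val: "\<exists>m::nat. emeasure M B = of_nat m" if "B \<in> sets M" "B \<subseteq> A" for B
  proof -
    have "emeasure M B < \<infinity>" using emeasure_mono[OF that(2) A(1)] A(3) by (rule le_less_trans)
    moreover obtain k where "emeasure M B = ennreal_of_enat k" using vals[OF \<open>B \<in> sets M\<close>] by auto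
    ultimately show ?thesis by (cases k) auto
  qed
  define Q where "Q m \<longleftrightarrow> m > 0 \<and> (\<exists>D\<in>sets M. D \<subseteq> A \<and> emeasure M D = of_nat m)" for m :: nat
  obtain a where "emeasure M A = of_nat a" using nat_val[OF A(1)] by blast
  then have "Q a" using A unfolding Q_def by force
  define m where "m = (LEAST m. Q m)"
  have "Q m" unfolding m_def using \<open>Q a\<close> by (rule LeastI)
  then obtain D where D: "m > 0" "D \<in> sets M" "D \<subseteq> A" "emeasure M D = of_nat m"
    unfolding Q_def by blast
  have dich: "emeasure M E = 0 \<or> emeasure M (D - E) = 0" if E: "E \<in> sets M" "E \<subseteq> D" for E
  proof (rule ccontr)
    assume neq: "\<not> ?thesis"
    have sub: "E \<subseteq> A" "D - E \<subseteq> A" "D - E \<in> sets M" using E D(2,3) by auto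
    obtain i where i: "emeasure M E = of_nat i" using nat_val[OF E(1) sub(1)] by blast
    obtain j where j: "emeasure M (D - E) = of_nat j" using nat_val[OF sub(3,2)] by blast
    have "E \<union> (D - E) = D" using E(2) by blast
    then have "emeasure M E + emeasure M (D - E) = emeasure M D"
      using plus_emeasure[OF E(1) sub(3)] by simp
    then have "(of_nat (i + j) :: ennreal) = of_nat m" by (simp add: i j D(4))
    then have "i + j = m" by (simp only: of_nat_eq_iff)
    moreover have "i \<noteq> 0" "j \<noteq> 0" using neq by (auto simp: i j)
    then have "i > 0" "j > 0" by auto
    moreover have "Q i" unfolding Q_def using \<open>i > 0\<close> i E(1) sub(1) by blast
    then have "m \<le> i" unfolding m_def by (rule Least_le)
    ultimately show False by linarith
  qed
  \<comment> \<open>Of the two parts into which \<open>G\<close> cuts \<open>D\<close>, the null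
    one. Removing it for every \<open>G\<close> costs no mass, and no member of the family separates
    two of the remaining points.\<close>
  define F where "F G = (if emeasure M (D \<inter> G) = 0 then D \<inter> G else D - G)" for G
  have "F G \<in> null_sets M" if "G \<in> \<G>" for G
  proof -
    have "G \<in> sets M" using \<G>(2) that by blast
    then show ?thesis
      using dich[of "D \<inter> G"] D(2) by (auto simp: F_def null_sets_def Diff_Int_distrib2 Diff_Int)
  qed
  then have null: "(\<Union>G\<in>\<G>. F G) \<in> null_sets M"
    using \<G>(1) by (intro null_sets_UN')
  define D' where "D' = D - (\<Union>G\<in>\<G>. F G)"
  have D': "emeasure M D' = of_nat m"
    unfolding D'_def D(4)[symmetric] by (rule emeasure_Diff_null_set[OF null D(2)])
  then have "D' \<noteq> {}" using D(1) by auto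
  then obtain H where H: "H \<in> D'" by blast
  have "D' = {H}"
  proof (rule ccontr)
    assume "D' \<noteq> {H}"
    then obtain H' where H': "H' \<in> D'" "H \<noteq> H'" using H by blast
    then obtain G where "G \<in> \<G>" "H \<in> G" "H' \<notin> G"
      using sep[of H H'] H D(3) by (auto simp: D'_def)
    then show False using H H' by (auto simp: D'_def F_def split: if_splits)
  qed
  then show ?thesis
    using that[of H] H D' D(1,3) by (auto simp: D'_def)
qed

section \<open>Membership in the zero cell\<close>

text \<open>Of the two parametrisations of the hyperplane only the one with positive offset gives a
  half-space containing 0, so the choice is unambiguous.\<close>

lemma origin_halfspace_hyperplane:
  assumes "u \<in> sphere 0 1" "t > 0"
  shows "origin_halfspace (hyperplane u t) = {y. y \<bullet> u \<le> t}"
  unfolding origin_halfspace_def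
proof (rule some_equality)
  show "0 \<in> {y. y \<bullet> u \<le> t} \<and>
      (\<exists>v s. v \<in> sphere 0 1 \<and> hyperplane u t = hyperplane v s \<and> {y. y \<bullet> u \<le> t} = {x. x \<bullet> v \<le> s})"
    using assms by auto
  fix S assume S: "0 \<in> S \<and> (\<exists>v s. v \<in> sphere 0 1 \<and> hyperplane u t = hyperplane v s \<and> S = {x. x \<bullet> v \<le> s})"
  then obtain v s where "v \<in> sphere 0 1" "hyperplane u t = hyperplane v s" "S = {x. x \<bullet> v \<le> s}" "s \<ge> 0"
    by auto
  then show "S = {y. y \<bullet> u \<le> t}"
    using hyperplane_eq_iff[OF assms(1), of v t s] assms(2) by auto
qed

lemma hyperplane_in_separating_iff:
  assumes "u \<in> sphere 0 1" "t > 0"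
  shows "hyperplane u t \<in> separating x \<longleftrightarrow> t < x \<bullet> u"
  using assms by (auto simp: separating_def hyperplane_in_image_iff)

lemma separatingE:
  assumes "H \<in> separating x"
  obtains u t where "u \<in> sphere 0 1" "0 < t" "t < x \<bullet> u" "H = hyperplane u t"
  using assms by (auto simp: separating_def hyperplane_image_def)

lemma separating_subset_near: "norm x < R \<Longrightarrow> separating x \<subseteq> near_hyperplanes R"
proof
  fix H assume R: "norm x < R" and "H \<in> separating x"
  then obtain u t where ut: "u \<in> sphere 0 1" "0 < t" "t < x \<bullet> u" "H = hyperplane u t"
    by (elim separatingE)
  moreover have "x \<bullet> u \<le> norm x" using norm_cauchy_schwarz[of x u] ut(1) by simp
  ultimately show "H \<in> near_hyperplanes R"
    using R by (simp add: near_hyperplanes_def hyperplane_in_image_iff)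
qed

text \<open>Supplies the countable family for the extraction of atoms. Cutting the basic open sets
  with \<open>T\<close>, where \<open>t > 0\<close>, leaves one parameter pair per hyperplane;
  otherwise the image of \<open>W\<close> could also contain \<open>H'\<close> through its reflected
  pair.\<close>

lemma hyperplanes_separating_family:
  obtains \<G> :: "'a::euclidean_space set set set" where "countable \<G>" "\<G> \<subseteq> sets hyperplane_borel"
    "\<And>x H H'. H \<in> separating x \<Longrightarrow> H' \<in> separating x \<Longrightarrow> H \<noteq> H' \<Longrightarrow> \<exists>G\<in>\<G>. H \<in> G \<and> H' \<notin> G"
proof -
  obtain \<B> :: "('a \<times> real) set set" where \<B>: "countable \<B>" "topological_basis \<B>"
    using ex_countable_basis by blast
  define T where "T = {p :: 'a \<times> real. 0 < snd p}"
  have "open T" unfolding T_def by (intro open_Collect_less continuous_intros)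
  show ?thesis
  proof (rule that[of "(\<lambda>W. hyperplane_image (T \<inter> W)) ` \<B>"])
    show "(\<lambda>W. hyperplane_image (T \<inter> W)) ` \<B> \<subseteq> sets hyperplane_borel"
      using \<open>open T\<close> topological_basis_open[OF \<B>(2)] by (auto intro!: hyperplane_image_sets open_Int)
    fix x and H H' :: "'a set" assume HH: "H \<in> separating x" "H' \<in> separating x" "H \<noteq> H'"
    obtain u t where ut: "u \<in> sphere 0 1" "0 < t" "t < x \<bullet> u" "H = hyperplane u t"
      using HH(1) by (rule separatingE)
    obtain v s where vs: "v \<in> sphere 0 1" "0 < s" "s < x \<bullet> v" "H' = hyperplane v s"
      using HH(2) by (rule separatingE)
    have "open (- {(v, s)})" "(u, t) \<in> - {(v, s)}"
      using HH(3) ut vs by (auto simp: open_closed)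
    then obtain W where W: "W \<in> \<B>" "(u, t) \<in> W" "W \<subseteq> - {(v, s)}"
      using topological_basisE[OF \<B>(2)] by blast
    then have "H \<in> hyperplane_image (T \<inter> W)" "H' \<notin> hyperplane_image (T \<inter> W)"
      using ut vs by (auto simp: hyperplane_in_image_iff T_def)
    then show "\<exists>G\<in>(\<lambda>W. hyperplane_image (T \<inter> W)) ` \<B>. H \<in> G \<and> H' \<notin> G"
      using W(1) by blast
  qed (use \<B>(1) in simp)
qed

lemma hyperplaneE_pos:
  assumes "H \<in> hyperplanes" "0 \<notin> H"
  obtains u t where "u \<in> sphere 0 1" "t > 0" "H = hyperplane u t"
proof -
  obtain u t where ut: "u \<in> sphere 0 1" "H = hyperplane u t"
    using assms(1) by (auto simp: hyperplanes_def)
  then have "t \<noteq> 0" using assms(2) by (auto simp: hyperplane_def)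
  moreover have "H = hyperplane (- u) (- t)" using ut by (auto simp: hyperplane_def)
  ultimately show ?thesis
    using ut that[of u t] that[of "- u" "- t"] by (cases "t > 0") auto
qed

text \<open>If \<open>separating x\<close> had positive mass, which is finite by \<open>fin\<close>,
  it would contain an atom, and the half-space of that atom excludes \<open>x\<close>. Conversely an
  atom lies in no null set, so it avoids both the origin and \<open>separating x\<close>, and its
  half-space contains \<open>x\<close>.\<close>

lemma zero_cell_iff:
  fixes \<mu> :: "'a::euclidean_space set measure"
  assumes sets: "sets \<mu> = sets hyperplane_borel"
    and vals: "\<And>B. B \<in> sets hyperplane_borel \<Longrightarrow> emeasure \<mu> B \<in> range ennreal_of_enat"
    and zero: "emeasure \<mu> {H \<in> hyperplanes. 0 \<in> H} = 0"
    and fin: "\<And>m::nat. emeasure \<mu> (near_hyperplanes (real m)) < \<infinity>"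
  shows "x \<in> zero_cell \<mu> \<longleftrightarrow> emeasure \<mu> (separating x) = 0"
proof
  assume x: "x \<in> zero_cell \<mu>"
  show "emeasure \<mu> (separating x) = 0"
  proof (rule ccontr)
    assume neq: "emeasure \<mu> (separating x) \<noteq> 0"
    obtain m :: nat where "norm x < real m" using reals_Archimedean2 by blast
    then have "emeasure \<mu> (separating x) \<le> emeasure \<mu> (near_hyperplanes (real m))"
      by (intro emeasure_mono separating_subset_near) (simp_all add: sets)
    then have "emeasure \<mu> (separating x) < \<infinity>" using fin[of m] by (rule le_less_trans)
    moreover obtain \<G> :: "'a set set set" where "countable \<G>" "\<G> \<subseteq> sets hyperplane_borel"
      "\<And>x H H'. H \<in> separating x \<Longrightarrow> H' \<in> separating x \<Longrightarrow> H \<noteq> H' \<Longrightarrow> \<exists>G\<in>\<G>. H \<in> G \<and> H' \<notin> G"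
      by (rule hyperplanes_separating_family) (use that in blast)
    ultimately obtain H where H: "H \<in> separating x" "emeasure \<mu> {H} > 0"
      by (rule_tac integer_valued_measure_atom[of \<mu> "separating x" \<G>])
         (use vals neq sets in \<open>simp_all add: zero_less_iff_neq_zero\<close>)
    then obtain u t where ut: "u \<in> sphere 0 1" "0 < t" "t < x \<bullet> u" "H = hyperplane u t"
      by (elim separatingE)
    moreover have "x \<in> origin_halfspace H" using x H(2) by (auto simp: zero_cell_def)
    ultimately show False by (simp add: origin_halfspace_hyperplane)
  qed
next
  assume x: "emeasure \<mu> (separating x) = 0"
  have null: "H \<notin> N" if "emeasure \<mu> {H} > 0" "N \<in> sets hyperplane_borel" "emeasure \<mu> N = 0" for H N
    using that emeasure_mono[of "{H}" N \<mu>] by (auto simp: sets)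
  show "x \<in> zero_cell \<mu>"
    unfolding zero_cell_def
  proof (intro INT_I, unfold mem_Collect_eq)
    fix H assume H: "emeasure \<mu> {H} > 0"
    \<comment> \<open>\<open>emeasure\<close> is 0 outside the sigma-algebra, so positive mass
      already makes the singleton measurable.\<close>
    then have "{H} \<in> sets \<mu>" by (intro emeasure_neq_0_sets) auto
    then have "H \<in> hyperplanes" using sets.sets_into_space by (force simp: sets)
    moreover have "H \<notin> {H \<in> hyperplanes. 0 \<in> H}"
      by (rule null[OF H hyperplanes_through_0_sets zero])
    ultimately obtain u t where ut: "u \<in> sphere 0 1" "t > 0" "H = hyperplane u t"
      using hyperplaneE_pos by blast
    moreover have "H \<notin> separating x" by (rule null[OF H separating_sets x])
    ultimately show "x \<in> origin_halfspace H"
      by (simp add: hyperplane_in_separating_iff origin_halfspace_hyperplane)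
  qed
qed

section \<open>Joint measurability of void events\<close>

text \<open>Countably many fixed sets generate the uncountable family \<open>separating x\<close>;
  the point \<open>x\<close> only selects indices, by an open condition. This turns voidness of
  \<open>separating x\<close> into a countable conjunction, measurable jointly in outcome and
  \<open>x\<close>.\<close>

lemma separating_eq_countable_UN:
  obtains q :: "nat \<Rightarrow> 'a::euclidean_space" and C :: "nat \<Rightarrow> nat \<Rightarrow> 'a set set"
  where "\<And>i m. C i m \<in> sets hyperplane_borel"
    "\<And>x. separating x = (\<Union>p\<in>{(i, m). dist (q i) x < inverse (real (Suc m))}. case_prod C p)"
proof -
  obtain D :: "'a set" where D: "countable D" "\<And>X. open X \<Longrightarrow> X \<noteq> {} \<Longrightarrow> \<exists>d\<in>D. d \<in> X"
    by (rule countable_dense_setE) (use that in blast)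
  have "D \<noteq> {}" using D(2)[of UNIV] by auto
  define q where "q = from_nat_into D"
  define C where "C i m = hyperplane_image {(u, t). 0 < t \<and> t + inverse (real (Suc m)) < q i \<bullet> u}" for i m
  show ?thesis
  proof (rule that[of C q])
    fix i m
    have "open {p :: 'a \<times> real. 0 < snd p \<and> snd p + inverse (real (Suc m)) < q i \<bullet> fst p}"
      by (intro open_Collect_conj open_Collect_less continuous_intros)
    then show "C i m \<in> sets hyperplane_borel"
      unfolding C_def by (intro hyperplane_image_sets) (simp add: case_prod_unfold)
  next
    fix x :: 'a
    have inner: "\<bar>q i \<bullet> u - x \<bullet> u\<bar> \<le> dist (q i) x" if "u \<in> sphere 0 1" for i u
      using Cauchy_Schwarz_ineq2[of "q i - x" u] that by (simp add: inner_diff_left dist_norm)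
    show "separating x = (\<Union>p\<in>{(i, m). dist (q i) x < inverse (real (Suc m))}. case_prod C p)" (is "_ = ?U")
    proof (intro equalityI subsetI)
      fix H assume "H \<in> separating x"
      then obtain u t where ut: "u \<in> sphere 0 1" "0 < t" "t < x \<bullet> u" "H = hyperplane u t"
        by (rule separatingE)
      \<comment> \<open>Half of the gap pays for the margin in \<open>C i m\<close>, the other half
        for replacing \<open>x\<close> by the nearby \<open>q i\<close>.\<close>
      obtain m where m: "inverse (real (Suc m)) < (x \<bullet> u - t) / 2"
        using reals_Archimedean[of "(x \<bullet> u - t) / 2"] ut(3) by auto
      have "ball x (inverse (real (Suc m))) \<noteq> {}" by simp
      then obtain d where "d \<in> D" "d \<in> ball x (inverse (real (Suc m)))"
        using D(2) open_ball by blast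
      then obtain i where i: "dist (q i) x < inverse (real (Suc m))"
        unfolding q_def using from_nat_into_surj[OF D(1) \<open>d \<in> D\<close>] by (auto simp: dist_commute)
      have "t + a < y" if "\<bar>y - z\<bar> \<le> b" "b < a" "a < (z - t) / 2" for a b y z :: real
        using abs_le_D2[OF that(1)] that(2,3) by (simp add: field_simps)
      from this[OF inner[OF ut(1)] i m] have "t + inverse (real (Suc m)) < q i \<bullet> u" .
      then have "H \<in> C i m"
        using ut by (simp add: C_def hyperplane_in_image_iff)
      then show "H \<in> ?U" using i by blast
    next
      fix H assume "H \<in> ?U"
      then obtain i m where im: "dist (q i) x < inverse (real (Suc m))" "H \<in> C i m" by blast
      then obtain u t where ut: "u \<in> sphere 0 1" "0 < t" "t + inverse (real (Suc m)) < q i \<bullet> u" "H = hyperplane u t"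
        by (auto simp: C_def hyperplane_image_def)
      then show "H \<in> separating x"
        using inner[OF ut(1), of i] im(1) by (simp add: hyperplane_in_separating_iff)
    qed
  qed
qed

lemma measurable_separating_null:
  fixes X :: "'w \<Rightarrow> 'a::euclidean_space set measure"
  assumes sets: "\<And>\<omega>. \<omega> \<in> space P \<Longrightarrow> sets (X \<omega>) = sets hyperplane_borel"
    and m: "\<And>B. B \<in> sets hyperplane_borel \<Longrightarrow> (\<lambda>\<omega>. emeasure (X \<omega>) B) \<in> borel_measurable P"
  shows "Measurable.pred (P \<Otimes>\<^sub>M lborel) (\<lambda>(\<omega>, x). emeasure (X \<omega>) (separating x) = 0)"
proof -
  obtain q and C :: "nat \<Rightarrow> nat \<Rightarrow> 'a set set" where
    C: "\<And>i m. C i m \<in> sets hyperplane_borel"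
      "\<And>x. separating x = (\<Union>p\<in>{(i, m). dist (q i) x < inverse (real (Suc m))}. case_prod C p)"
    by (rule separating_eq_countable_UN) (use that in blast)
  have [measurable]: "(\<lambda>\<omega>. emeasure (X \<omega>) (C i k)) \<in> borel_measurable P" for i k
    by (rule m[OF C(1)])
  have "emeasure (X \<omega>) (separating x) = 0 \<longleftrightarrow>
      (\<forall>i k. dist (q i) x < inverse (real (Suc k)) \<longrightarrow> emeasure (X \<omega>) (C i k) = 0)"
    if "\<omega> \<in> space P" for \<omega> x
  proof
    assume x: "emeasure (X \<omega>) (separating x) = 0"
    show "\<forall>i k. dist (q i) x < inverse (real (Suc k)) \<longrightarrow> emeasure (X \<omega>) (C i k) = 0"
    proof (intro allI impI)
      fix i k assume "dist (q i) x < inverse (real (Suc k))"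
      then have "C i k \<subseteq> separating x" unfolding C(2) by blast
      then have "emeasure (X \<omega>) (C i k) \<le> emeasure (X \<omega>) (separating x)"
        by (rule emeasure_mono) (simp add: sets[OF that])
      then show "emeasure (X \<omega>) (C i k) = 0" using x by simp
    qed
  next
    assume *: "\<forall>i k. dist (q i) x < inverse (real (Suc k)) \<longrightarrow> emeasure (X \<omega>) (C i k) = 0"
    have "separating x \<in> null_sets (X \<omega>)"
      unfolding C(2)
      by (rule null_sets_UN') (use * C(1) sets[OF that] in \<open>auto simp: null_sets_def\<close>)
    then show "emeasure (X \<omega>) (separating x) = 0" by auto
  qed
  then have "Measurable.pred (P \<Otimes>\<^sub>M lborel) (\<lambda>(\<omega>, x). emeasure (X \<omega>) (separating x) = 0) \<longleftrightarrow>
    Measurable.pred (P \<Otimes>\<^sub>M lborel) (\<lambda>(\<omega>, x). \<forall>i k. dist (q i) x < inverse (real (Suc k)) \<longrightarrow>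
       emeasure (X \<omega>) (C i k) = 0)"
    by (intro measurable_cong) (auto simp: space_pair_measure)
  also have "\<dots>" by measurable
  finally show ?thesis .
qed

section \<open>Consequences of the Poisson law\<close>

lemma poisson_process_void:
  assumes "poisson_process P \<Theta> X" "B \<in> sets \<Theta>" "emeasure \<Theta> B < \<infinity>"
  shows "measure P {\<omega> \<in> space P. emeasure (X \<omega>) B = 0} = exp (- measure \<Theta> B)"
proof -
  have "measure P {\<omega> \<in> space P. emeasure (X \<omega>) B = of_nat 0}
      = exp (- measure \<Theta> B) * measure \<Theta> B ^ 0 / fact 0"
    using assms unfolding poisson_process_def by blast
  then show ?thesis by simp
qed

text \<open>The Poisson weights of the finite values sum to 1 by the exponential series, which
  leaves no probability for the value \<infinity>.\<close>

lemma poisson_process_AE_finite: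
  assumes "prob_space P" and X: "poisson_process P \<Theta> X" and B: "B \<in> sets \<Theta>" "emeasure \<Theta> B < \<infinity>"
  shows "AE \<omega> in P. emeasure (X \<omega>) B < \<infinity>"
proof -
  interpret prob_space P by fact
  have [measurable]: "(\<lambda>\<omega>. emeasure (X \<omega>) B) \<in> borel_measurable P"
    using X B(1) by (auto simp: poisson_process_def point_process_def)
  define E where "E j = {\<omega> \<in> space P. emeasure (X \<omega>) B = of_nat j}" for j :: nat
  have E [measurable]: "E j \<in> sets P" for j unfolding E_def by measurable
  have "(\<lambda>j. prob (E j)) sums prob (\<Union>j. E j)"
    by (rule finite_measure_UNION) (auto simp: disjoint_family_on_def E_def)
  moreover have "prob (E j) = exp (- measure \<Theta> B) * (measure \<Theta> B ^ j /\<^sub>R fact j)" for j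
    using X B unfolding poisson_process_def E_def by (simp add: divide_inverse)
  moreover have "(\<lambda>j. exp (- measure \<Theta> B) * (measure \<Theta> B ^ j /\<^sub>R fact j)) sums
      (exp (- measure \<Theta> B) * exp (measure \<Theta> B))"
    by (intro sums_mult exp_converges)
  ultimately have "prob (\<Union>j. E j) = exp (- measure \<Theta> B) * exp (measure \<Theta> B)"
    using sums_unique2 by force
  then have "prob (\<Union>j. E j) = 1" by (simp flip: exp_add)
  then have "AE \<omega> in P. \<omega> \<in> (\<Union>j. E j)" by (rule AE_prob_1)
  then show ?thesis
    by eventually_elim (auto simp: E_def less_top[symmetric])
qed

text \<open>The quantifier over \<open>x\<close> stands inside the almost sure statement: only
  countably many events have to be excluded, one for the hyperplanes through 0 and one for each
  integer radius.\<close>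

lemma AE_zero_cell_iff:
  fixes X :: "'w \<Rightarrow> 'a::euclidean_space set measure"
  assumes "prob_space P" and X: "poisson_process P (hyperplane_intensity \<gamma> r) X" and r: "r > 0"
  shows "AE \<omega> in P. \<forall>x. x \<in> zero_cell (X \<omega>) \<longleftrightarrow> emeasure (X \<omega>) (separating x) = 0"
proof -
  interpret prob_space P by fact
  have pp: "point_process P (hyperplane_intensity \<gamma> r) X"
    using X by (simp add: poisson_process_def)
  let ?N = "{H \<in> hyperplanes. (0::'a) \<in> H}"
  have [measurable]: "(\<lambda>\<omega>. emeasure (X \<omega>) ?N) \<in> borel_measurable P"
    using pp hyperplanes_through_0_sets by (auto simp: point_process_def)
  have "prob {\<omega> \<in> space P. emeasure (X \<omega>) ?N = 0} = 1"
    using poisson_process_void[OF X, of ?N] emeasure_hyperplanes_through_0[of \<gamma> r, where 'a='a]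
      hyperplanes_through_0_sets[where 'a='a] by (simp add: measure_def)
  then have "AE \<omega> in P. \<omega> \<in> {\<omega> \<in> space P. emeasure (X \<omega>) ?N = 0}"
    by (rule AE_prob_1)
  moreover have "AE \<omega> in P. \<forall>m::nat. emeasure (X \<omega>) (near_hyperplanes (real m)) < \<infinity>"
    unfolding AE_all_countable
    by (intro allI poisson_process_AE_finite[OF \<open>prob_space P\<close> X] emeasure_near_hyperplanes_finite[OF r]) auto
  ultimately show ?thesis
    using AE_space
  proof eventually_elim
    case (elim \<omega>)
    then show ?case
      using pp by (intro allI zero_cell_iff) (auto simp: point_process_def)
  qed
qed

section \<open>Volume moments\<close>

lemma nn_integral_exp_minus_atLeast:
  "(\<integral>\<^sup>+s\<in>{T..}. ennreal (exp (- s)) \<partial>lborel) = ennreal (exp (- T))"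
proof -
  have "((\<lambda>s::real. - exp (- s)) \<longlongrightarrow> - 0) at_top"
    by (intro tendsto_minus filterlim_compose[OF exp_at_bot] filterlim_uminus_at_bot_at_top)
  then have "(\<integral>\<^sup>+s\<in>{T..}. ennreal (exp (- s)) \<partial>lborel) = ennreal (- 0 - (- exp (- T)))"
    by (intro nn_integral_FTC_atLeast) (auto intro!: derivative_eq_intros)
  then show ?thesis by simp
qed

lemma emeasure_norm_powr_le:
  assumes "a > 0" "r > 0" "s \<ge> 0"
  shows "emeasure lborel {x :: 'a::euclidean_space. a * norm x powr r \<le> s}
    = ennreal (unit_ball_vol (real DIM('a)) * (s / a) powr (real DIM('a) / r))"
proof -
  have "a * norm x powr r \<le> s \<longleftrightarrow> norm x \<le> (s / a) powr (1 / r)" for x :: 'a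
  proof -
    have "norm x \<le> (s / a) powr (1 / r) \<longleftrightarrow> norm x powr r \<le> ((s / a) powr (1 / r)) powr r"
      using assms(2) powr_mono2[of r "norm x" "(s / a) powr (1 / r)"]
        powr_less_mono2[of r "(s / a) powr (1 / r)" "norm x"]
      by (cases "norm x \<le> (s / a) powr (1 / r)") auto
    also have "((s / a) powr (1 / r)) powr r = s / a"
      using assms by (simp add: powr_powr)
    finally show ?thesis using assms(1) by (simp add: field_simps)
  qed
  then have "{x :: 'a. a * norm x powr r \<le> s} = {x. norm x \<le> (s / a) powr (1 / r)}"
    by (rule Collect_cong)
  also have "\<dots> = cball 0 ((s / a) powr (1 / r))"
    by (simp add: cball_def)
  finally show ?thesis
    using assms by (cases "s = 0") (simp_all add: emeasure_cball powr_power)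
qed

text \<open>The sublevel set is a ball of radius \<open>(s / a) powr (1 / r)\<close>, so the power
  of its volume is a multiple of \<open>s powr (k * n / r)\<close> and Euler's integral for Gamma
  remains.\<close>

lemma nn_integral_exp_minus_volume_power:
  assumes a: "a > 0" and r: "r > 0"
  shows "(\<integral>\<^sup>+s\<in>{0..}. ennreal (exp (- s)) * emeasure lborel {x :: 'a::euclidean_space. a * norm x powr r \<le> s} ^ k \<partial>lborel)
    = ennreal (Gamma (real k * real DIM('a) / r + 1) * unit_ball_vol (real DIM('a)) ^ k
        * (1 / a) powr (real k * real DIM('a) / r))"
proof -
  let ?\<kappa> = "unit_ball_vol (real DIM('a))" and ?z = "real k * real DIM('a) / r"
  define C where "C = ?\<kappa> ^ k * (1 / a) powr ?z"
  have C: "C \<ge> 0" by (simp add: C_def)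
  have z: "?z + 1 > 0" using r by (simp add: add_nonneg_pos)
  have "(\<integral>\<^sup>+s\<in>{0..}. ennreal (exp (- s)) * emeasure lborel {x :: 'a. a * norm x powr r \<le> s} ^ k \<partial>lborel)
      = (\<integral>\<^sup>+s. ennreal C * ennreal (indicator {0..} s * s powr (?z + 1 - 1) / exp s) \<partial>lborel)"
  proof (rule nn_integral_cong_AE)
    \<comment> \<open>The point \<open>s = 0\<close> is set aside: for \<open>k = 0\<close> the left
      side is 1 there, but the right side is 0 because \<open>0 powr 0 = 0\<close>.\<close>
    show "AE s in lborel. ennreal (exp (- s)) * emeasure lborel {x :: 'a. a * norm x powr r \<le> s} ^ k * indicator {0..} s
      = ennreal C * ennreal (indicator {0..} s * s powr (?z + 1 - 1) / exp s)"
      using AE_lborel_singleton[of "0::real"]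
    proof eventually_elim
      case (elim s)
      show ?case
      proof (cases "s > 0")
        case True
        have "(?\<kappa> * (s / a) powr (real DIM('a) / r)) ^ k = ?\<kappa> ^ k * (s / a) powr ?z"
          using True a by (simp add: power_mult_distrib powr_power mult.commute)
        also have "(s / a) powr ?z = s powr ?z * (1 / a) powr ?z"
          using powr_mult[of s "1 / a" ?z] by simp
        finally have "(?\<kappa> * (s / a) powr (real DIM('a) / r)) ^ k = C * s powr ?z"
          by (simp add: C_def)
        then have "exp (- s) * (?\<kappa> * (s / a) powr (real DIM('a) / r)) ^ k = C * (s powr ?z / exp s)"
          by (simp add: exp_minus field_simps)
        moreover have "emeasure lborel {x :: 'a. a * norm x powr r \<le> s} ^ k
            = ennreal ((?\<kappa> * (s / a) powr (real DIM('a) / r)) ^ k)"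
          using True by (simp only: emeasure_norm_powr_le[OF a r less_imp_le[OF True]]) (rule ennreal_power, simp)
        ultimately show ?thesis
          using True C by (simp flip: ennreal_mult')
      qed (use elim in \<open>auto simp: indicator_def\<close>)
    qed
  qed
  also have "\<dots> = ennreal C * ennreal (Gamma (?z + 1))"
    unfolding Gamma_conv_nn_integral_real[OF z] by (rule nn_integral_cmult) measurable
  also have "\<dots> = ennreal (C * Gamma (?z + 1))"
    using C z by (simp add: ennreal_mult Gamma_real_pos less_imp_le)
  finally show ?thesis by (simp add: C_def ac_simps)
qed

text \<open>A layer-cake argument with density \<open>exp (- s)\<close> reduces this to the case
  \<open>k = 1\<close> of the volume powers.\<close>

lemma nn_integral_exp_minus_norm_powr:
  assumes a: "a > 0" and r: "r > 0"
  shows "(\<integral>\<^sup>+x. ennreal (exp (- (a * norm (x :: 'a::euclidean_space) powr r))) \<partial>lborel)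
    = ennreal (Gamma (real DIM('a) / r + 1) * unit_ball_vol (real DIM('a)) * (1 / a) powr (real DIM('a) / r))"
proof -
  have "(\<integral>\<^sup>+x. ennreal (exp (- (a * norm (x :: 'a) powr r))) \<partial>lborel)
      = (\<integral>\<^sup>+x. \<integral>\<^sup>+s. ennreal (exp (- s)) * indicator {0..} s * (if a * norm (x :: 'a) powr r \<le> s then 1 else 0) \<partial>lborel \<partial>lborel)"
  proof (rule nn_integral_cong)
    fix x :: 'a
    have "0 \<le> a * norm x powr r" using a by simp
    then have "(\<integral>\<^sup>+s\<in>{a * norm x powr r..}. ennreal (exp (- s)) \<partial>lborel)
        = (\<integral>\<^sup>+s. ennreal (exp (- s)) * indicator {0..} s * (if a * norm (x :: 'a) powr r \<le> s then 1 else 0) \<partial>lborel)"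
      by (intro nn_integral_cong) (simp add: indicator_def)
    then show "ennreal (exp (- (a * norm (x :: 'a) powr r)))
        = (\<integral>\<^sup>+s. ennreal (exp (- s)) * indicator {0..} s * (if a * norm (x :: 'a) powr r \<le> s then 1 else 0) \<partial>lborel)"
      by (simp only: nn_integral_exp_minus_atLeast)
  qed
  also have "\<dots> = (\<integral>\<^sup>+s. \<integral>\<^sup>+x. ennreal (exp (- s)) * indicator {0..} s * (if a * norm (x :: 'a) powr r \<le> s then 1 else 0) \<partial>lborel \<partial>lborel)"
    by (rule lborel_pair.Fubini'[symmetric]) measurable
  also have "\<dots> = (\<integral>\<^sup>+s\<in>{0..}. ennreal (exp (- s)) * emeasure lborel {x :: 'a. a * norm x powr r \<le> s} ^ 1 \<partial>lborel)"
  proof (rule nn_integral_cong)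
    fix s :: real
    have "(\<integral>\<^sup>+x. (if a * norm (x :: 'a) powr r \<le> s then 1 else 0) \<partial>lborel)
        = (\<integral>\<^sup>+x. indicator {x :: 'a. a * norm x powr r \<le> s} x \<partial>lborel)"
      by (intro nn_integral_cong) (simp add: indicator_def)
    also have "\<dots> = emeasure lborel {x :: 'a. a * norm x powr r \<le> s}"
      by (rule nn_integral_indicator) measurable
    finally show "(\<integral>\<^sup>+x. ennreal (exp (- s)) * indicator {0..} s * (if a * norm (x :: 'a) powr r \<le> s then 1 else 0) \<partial>lborel)
        = ennreal (exp (- s)) * emeasure lborel {x :: 'a. a * norm x powr r \<le> s} ^ 1 * indicator {0..} s"
      by (subst nn_integral_cmult) (measurable, simp add: ac_simps)
  qed
  also have "\<dots> = ennreal (Gamma (real DIM('a) / r + 1) * unit_ball_vol (real DIM('a)) * (1 / a) powr (real DIM('a) / r))"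
    unfolding nn_integral_exp_minus_volume_power[OF a r] by simp
  finally show ?thesis .
qed

text \<open>For fixed \<open>s\<close> the condition that all \<open>a * norm (x i) powr r\<close>
  are at most \<open>s\<close> factors over \<open>i\<close>, giving the \<open>k\<close>-th power
  of one ball volume. The indicator of \<open>{0..}\<close> matters for \<open>k = 0\<close>, where
  the empty product puts no lower bound on \<open>s\<close>.\<close>

lemma nn_integral_PiM_exp_minus:
  assumes a: "a > 0" and r: "r > 0"
  shows "(\<integral>\<^sup>+x. \<integral>\<^sup>+s. ennreal (exp (- s)) * indicator {0..} s *
            (\<Prod>i<k. (if a * norm (x i :: 'a::euclidean_space) powr r \<le> s then 1 else 0)) \<partial>lborel \<partial>Pi\<^sub>M {..<k} (\<lambda>_. lborel))
    = ennreal (Gamma (real k * real DIM('a) / r + 1) * unit_ball_vol (real DIM('a)) ^ k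
        * (1 / a) powr (real k * real DIM('a) / r))"
proof -
  interpret P: product_sigma_finite "\<lambda>_::nat. lborel :: 'a measure" by standard
  interpret F: finite_product_sigma_finite "\<lambda>_::nat. lborel :: 'a measure" "{..<k}" by standard simp
  interpret pair_sigma_finite "Pi\<^sub>M {..<k} (\<lambda>_. lborel :: 'a measure)" "lborel :: real measure"
    by standard
  have "(\<integral>\<^sup>+x. \<integral>\<^sup>+s. ennreal (exp (- s)) * indicator {0..} s *
            (\<Prod>i<k. (if a * norm (x i :: 'a) powr r \<le> s then 1 else 0)) \<partial>lborel \<partial>Pi\<^sub>M {..<k} (\<lambda>_. lborel))
      = (\<integral>\<^sup>+s. \<integral>\<^sup>+x. ennreal (exp (- s)) * indicator {0..} s *
            (\<Prod>i<k. (if a * norm (x i :: 'a) powr r \<le> s then 1 else 0)) \<partial>Pi\<^sub>M {..<k} (\<lambda>_. lborel) \<partial>lborel)"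
    by (rule Fubini'[symmetric]) measurable
  also have "\<dots> = (\<integral>\<^sup>+s\<in>{0..}. ennreal (exp (- s)) * emeasure lborel {x :: 'a. a * norm x powr r \<le> s} ^ k \<partial>lborel)"
  proof (rule nn_integral_cong)
    fix s :: real
    have "(\<integral>\<^sup>+x. (\<Prod>i<k. (if a * norm (x i :: 'a) powr r \<le> s then 1 else 0)) \<partial>Pi\<^sub>M {..<k} (\<lambda>_. lborel))
        = (\<Prod>i<k. \<integral>\<^sup>+x. (if a * norm (x :: 'a) powr r \<le> s then 1 else 0) \<partial>lborel)"
      by (rule P.product_nn_integral_prod) auto
    also have "(\<integral>\<^sup>+x. (if a * norm (x :: 'a) powr r \<le> s then 1 else 0) \<partial>lborel)
        = (\<integral>\<^sup>+x. indicator {x :: 'a. a * norm x powr r \<le> s} x \<partial>lborel)"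
      by (intro nn_integral_cong) (simp add: indicator_def)
    also have "\<dots> = emeasure lborel {x :: 'a. a * norm x powr r \<le> s}"
      by (rule nn_integral_indicator) measurable
    finally have "(\<integral>\<^sup>+x. (\<Prod>i<k. (if a * norm (x i :: 'a) powr r \<le> s then 1 else 0)) \<partial>Pi\<^sub>M {..<k} (\<lambda>_. lborel))
        = emeasure lborel {x :: 'a. a * norm x powr r \<le> s} ^ k" by simp
    then show "(\<integral>\<^sup>+x. ennreal (exp (- s)) * indicator {0..} s *
            (\<Prod>i<k. (if a * norm (x i :: 'a) powr r \<le> s then 1 else 0)) \<partial>Pi\<^sub>M {..<k} (\<lambda>_. lborel))
        = ennreal (exp (- s)) * emeasure lborel {x :: 'a. a * norm x powr r \<le> s} ^ k * indicator {0..} s"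
      by (subst nn_integral_cmult) (measurable, simp add: ac_simps)
  qed
  also note nn_integral_exp_minus_volume_power[OF a r]
  finally show ?thesis .
qed

section \<open>Moments as void probabilities\<close>

lemma zero_cell_volume_moment:
  fixes X :: "'w \<Rightarrow> 'a::euclidean_space set measure"
  assumes "prob_space P" and X: "poisson_process P (hyperplane_intensity \<gamma> r) X" and r: "r > 0"
  shows "(\<integral>\<^sup>+\<omega>. emeasure lborel (zero_cell (X \<omega>)) ^ k \<partial>P)
    = (\<integral>\<^sup>+x. ennreal (exp (- measure (hyperplane_intensity \<gamma> r) (\<Union>i<k. separating (x i :: 'a))))
         \<partial>Pi\<^sub>M {..<k} (\<lambda>_. lborel))"
proof -
  interpret prob_space P by fact
  interpret PL: product_sigma_finite "\<lambda>_::nat. lborel :: 'a measure" by standard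
  interpret F: finite_product_sigma_finite "\<lambda>_::nat. lborel :: 'a measure" "{..<k}" by standard simp
  interpret pair_sigma_finite P "Pi\<^sub>M {..<k} (\<lambda>_. lborel :: 'a measure)" by standard
  let ?M = "Pi\<^sub>M {..<k} (\<lambda>_. lborel :: 'a measure)"
  have pp: "point_process P (hyperplane_intensity \<gamma> r) X"
    using X by (simp add: poisson_process_def)
  have sets_X: "sets (X \<omega>) = sets hyperplane_borel" if "\<omega> \<in> space P" for \<omega>
    using pp that by (auto simp: point_process_def)
  have meas_X: "(\<lambda>\<omega>. emeasure (X \<omega>) B) \<in> borel_measurable P" if "B \<in> sets hyperplane_borel" for B
    using pp that by (auto simp: point_process_def)
  \<comment> \<open>Stands in for the zero cell: almost surely equal to it, but measurable jointly
    with the outcome.\<close>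
  define Z where "Z \<omega> = {x. emeasure (X \<omega>) (separating x) = 0}" for \<omega>
  have "Measurable.pred (P \<Otimes>\<^sub>M lborel) (\<lambda>(\<omega>, x). emeasure (X \<omega>) (separating x) = 0)"
    by (rule measurable_separating_null[OF sets_X meas_X])
  then have Z_meas: "Measurable.pred (P \<Otimes>\<^sub>M lborel) (\<lambda>p. snd p \<in> Z (fst p))"
    by (simp add: Z_def case_prod_unfold)
  have Z_sets: "Z \<omega> \<in> sets borel" if "\<omega> \<in> space P" for \<omega>
  proof -
    have "(\<lambda>x. (\<omega>, x)) \<in> measurable lborel (P \<Otimes>\<^sub>M lborel)" using that by simp
    from measurable_compose[OF this Z_meas] show ?thesis by (simp add: pred_def)
  qed
  have "Measurable.pred (P \<Otimes>\<^sub>M ?M) (\<lambda>p. snd p i \<in> Z (fst p))" if "i \<in> {..<k}" for i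
  proof -
    have "(\<lambda>p. (fst p, snd p i)) \<in> measurable (P \<Otimes>\<^sub>M ?M) (P \<Otimes>\<^sub>M lborel)"
      using that by measurable
    from measurable_compose[OF this Z_meas] show ?thesis by simp
  qed
  then have ind_meas: "(\<lambda>p. \<Prod>i<k. indicator (Z (fst p)) (snd p i) :: ennreal) \<in> borel_measurable (P \<Otimes>\<^sub>M ?M)"
    by (intro borel_measurable_prod_ennreal) (auto simp: indicator_def[abs_def] intro!: measurable_If)
  have "AE \<omega> in P. zero_cell (X \<omega>) = Z \<omega>"
    using AE_zero_cell_iff[OF \<open>prob_space P\<close> X r] by eventually_elim (auto simp: Z_def)
  then have "(\<integral>\<^sup>+\<omega>. emeasure lborel (zero_cell (X \<omega>)) ^ k \<partial>P) = (\<integral>\<^sup>+\<omega>. emeasure lborel (Z \<omega>) ^ k \<partial>P)"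
    by (intro nn_integral_cong_AE) (auto elim!: eventually_mono)
  also have "\<dots> = (\<integral>\<^sup>+\<omega>. \<integral>\<^sup>+x. (\<Prod>i<k. indicator (Z \<omega>) (x i)) \<partial>?M \<partial>P)"
  proof (rule nn_integral_cong)
    fix \<omega> assume "\<omega> \<in> space P"
    note [measurable] = Z_sets[OF this]
    have "(\<integral>\<^sup>+x. (\<Prod>i<k. indicator (Z \<omega>) (x i)) \<partial>?M) = (\<Prod>i<k. \<integral>\<^sup>+x. indicator (Z \<omega>) x \<partial>lborel)"
      by (rule PL.product_nn_integral_prod) auto
    then show "emeasure lborel (Z \<omega>) ^ k = (\<integral>\<^sup>+x. (\<Prod>i<k. indicator (Z \<omega>) (x i)) \<partial>?M)"
      by simp
  qed
  also have "\<dots> = (\<integral>\<^sup>+x. \<integral>\<^sup>+\<omega>. (\<Prod>i<k. indicator (Z \<omega>) (x i)) \<partial>P \<partial>?M)"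
    using ind_meas by (intro Fubini'[symmetric]) (simp add: case_prod_unfold)
  also have "\<dots> = (\<integral>\<^sup>+x. ennreal (exp (- measure (hyperplane_intensity \<gamma> r) (\<Union>i<k. separating (x i)))) \<partial>?M)"
  proof (rule nn_integral_cong)
    fix x :: "nat \<Rightarrow> 'a"
    define B where "B = (\<Union>i<k. separating (x i))"
    have B: "B \<in> sets hyperplane_borel" unfolding B_def by (intro sets.finite_UN) auto
    \<comment> \<open>One ball holds all \<open>k\<close> points, so the union of the separating
      sets has finite intensity and the Poisson law gives its void probability. The sum of the norms
      is a bound that also makes sense for \<open>k = 0\<close>.\<close>
    obtain m :: nat where m: "(\<Sum>i<k. norm (x i)) < real m" using reals_Archimedean2 by blast
    have "norm (x i) < real m" if "i < k" for i
      using m member_le_sum[of i "{..<k}" "\<lambda>i. norm (x i)"] that by simp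
    then have "B \<subseteq> near_hyperplanes (real m)"
      unfolding B_def using separating_subset_near by blast
    then have "emeasure (hyperplane_intensity \<gamma> r) B \<le> emeasure (hyperplane_intensity \<gamma> r) (near_hyperplanes (real m) :: 'a set set)"
      by (rule emeasure_mono) simp
    then have fin: "emeasure (hyperplane_intensity \<gamma> r) B < \<infinity>"
      using emeasure_near_hyperplanes_finite[OF r, of "real m" \<gamma>, where 'a='a] le_less_trans by auto
    have [measurable]: "(\<lambda>\<omega>. emeasure (X \<omega>) B) \<in> borel_measurable P" by (rule meas_X[OF B])
    have "(\<Prod>i<k. indicator (Z \<omega>) (x i)) = (indicator {\<omega> \<in> space P. emeasure (X \<omega>) B = 0} \<omega> :: ennreal)"
      if \<omega>: "\<omega> \<in> space P" for \<omega>
    proof -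
      have "emeasure (X \<omega>) B = 0 \<longleftrightarrow> (\<forall>i<k. emeasure (X \<omega>) (separating (x i)) = 0)"
      proof
        assume *: "emeasure (X \<omega>) B = 0"
        show "\<forall>i<k. emeasure (X \<omega>) (separating (x i)) = 0"
        proof (intro allI impI)
          fix i assume "i < k"
          then have "emeasure (X \<omega>) (separating (x i)) \<le> emeasure (X \<omega>) B"
            using B by (intro emeasure_mono) (auto simp: B_def sets_X[OF \<omega>])
          then show "emeasure (X \<omega>) (separating (x i)) = 0" using * by simp
        qed
      next
        assume *: "\<forall>i<k. emeasure (X \<omega>) (separating (x i)) = 0"
        have "B \<in> null_sets (X \<omega>)"
          unfolding B_def by (rule null_sets_UN') (use * sets_X[OF \<omega>] in \<open>auto simp: null_sets_def\<close>)
        then show "emeasure (X \<omega>) B = 0" by auto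
      qed
      then show ?thesis
        using \<omega> by (auto simp: indicator_def Z_def intro!: prod_zero)
    qed
    then have "(\<integral>\<^sup>+\<omega>. (\<Prod>i<k. indicator (Z \<omega>) (x i)) \<partial>P)
        = (\<integral>\<^sup>+\<omega>. indicator {\<omega> \<in> space P. emeasure (X \<omega>) B = 0} \<omega> \<partial>P)"
      by (rule nn_integral_cong)
    also have "\<dots> = emeasure P {\<omega> \<in> space P. emeasure (X \<omega>) B = 0}"
      by (rule nn_integral_indicator) measurable
    also have "\<dots> = ennreal (exp (- measure (hyperplane_intensity \<gamma> r) B))"
      using poisson_process_void[OF X _ fin] B by (simp add: emeasure_eq_measure)
    finally show "(\<integral>\<^sup>+\<omega>. (\<Prod>i<k. indicator (Z \<omega>) (x i)) \<partial>P)
        = ennreal (exp (- measure (hyperplane_intensity \<gamma> r) (\<Union>i<k. separating (x i))))"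
      unfolding B_def .
  qed
  finally show ?thesis .
qed

section \<open>The two moment bounds\<close>

theorem proposition1:
  fixes P :: "'w measure"
    and X :: "'w \<Rightarrow> (real ^ 'n) set measure"
    and e :: "real ^ 'n"
    and \<gamma> r :: real
  defines "n \<equiv> real CARD('n)"
  defines "\<kappa> \<equiv> unit_ball_vol n"
  assumes "CARD('n) \<ge> 2" and "\<gamma> > 0" and "r > 0"
    and "prob_space P"
    and "poisson_process P (hyperplane_intensity \<gamma> r) X"
    and "norm e = 1"
  shows "(\<forall>k::nat.
            ennreal (Gamma (n / r + 1) ^ k * \<kappa> ^ k *
                (n * \<kappa> * r / (2 * \<gamma> * sphere_const e r)) powr (real k * n / r))
              \<le> (\<integral>\<^sup>+\<omega>. emeasure lborel (zero_cell (X \<omega>)) ^ k \<partial>P) \<and>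
            (\<integral>\<^sup>+\<omega>. emeasure lborel (zero_cell (X \<omega>)) ^ k \<partial>P)
              \<le> ennreal (Gamma (real k * n / r + 1) * \<kappa> ^ k *
                (n * \<kappa> * r / (2 * \<gamma> * sphere_const e r)) powr (real k * n / r))) \<and>
         (\<integral>\<^sup>+\<omega>. emeasure lborel (zero_cell (X \<omega>)) \<partial>P)
            = ennreal (Gamma (n / r + 1) * \<kappa> *
                (n * \<kappa> * r / (2 * \<gamma> * sphere_const e r)) powr (n / r))"
proof -
  let ?\<Theta> = "hyperplane_intensity \<gamma> r :: (real ^ 'n) set measure"
  let ?V = "\<lambda>k::nat. \<integral>\<^sup>+\<omega>. emeasure lborel (zero_cell (X \<omega>)) ^ k \<partial>P"
  interpret PL: product_sigma_finite "\<lambda>_::nat. lborel :: (real ^ 'n) measure" by standard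
  define a where "a = 2 * \<gamma> * sphere_const e r / (n * \<kappa> * r)"
  define b where "b = n * \<kappa> * r / (2 * \<gamma> * sphere_const e r)"
  have r: "r > 0" and n: "n > 0" and \<kappa>: "\<kappa> > 0"
    using assms(3,5) by (simp_all add: n_def \<kappa>_def)
  have c: "sphere_const e r > 0" by (rule sphere_const_pos[OF assms(3,8,5)])
  have a: "a > 0" using c r n \<kappa> \<open>\<gamma> > 0\<close> by (simp add: a_def)
  have b: "1 / a = b" "b > 0" using c r n \<kappa> \<open>\<gamma> > 0\<close> by (simp_all add: a_def b_def)
  have DIM: "real DIM(real ^ 'n) = n" by (simp add: n_def)
  have \<Theta>: "emeasure ?\<Theta> (separating x) = ennreal (a * norm x powr r)" for x
    using emeasure_separating[OF assms(3,4,5,8)] by (simp add: a_def \<kappa>_def n_def)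
  then have \<Theta>': "measure ?\<Theta> (separating x) = a * norm x powr r" for x
    using a by (simp add: measure_def)
  have moment: "?V k = (\<integral>\<^sup>+x. ennreal (exp (- measure ?\<Theta> (\<Union>i<k. separating (x i))))
      \<partial>Pi\<^sub>M {..<k} (\<lambda>_. lborel))" for k
    by (rule zero_cell_volume_moment[OF assms(6,7,5)])
  have single: "(\<integral>\<^sup>+x. ennreal (exp (- (a * norm (x :: real ^ 'n) powr r))) \<partial>lborel)
      = ennreal (Gamma (n / r + 1) * \<kappa> * b powr (n / r))"
    unfolding nn_integral_exp_minus_norm_powr[OF a r] DIM b \<kappa>_def ..
  have lower: "ennreal (Gamma (n / r + 1) ^ k * \<kappa> ^ k * b powr (real k * n / r)) \<le> ?V k" for k
  proof -
    have "Gamma (n / r + 1) > 0" using n r by (intro Gamma_real_pos) (simp add: add_pos_pos)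
    then have "ennreal (Gamma (n / r + 1) ^ k * \<kappa> ^ k * b powr (real k * n / r))
        = ennreal (Gamma (n / r + 1) * \<kappa> * b powr (n / r)) ^ k"
      using \<kappa> b by (simp add: ennreal_power power_mult_distrib powr_power mult.commute)
    also have "\<dots> = (\<Prod>i<k. \<integral>\<^sup>+x. ennreal (exp (- (a * norm (x :: real ^ 'n) powr r))) \<partial>lborel)"
      by (simp add: single)
    also have "\<dots> = (\<integral>\<^sup>+x. (\<Prod>i<k. ennreal (exp (- (a * norm (x i :: real ^ 'n) powr r)))) \<partial>Pi\<^sub>M {..<k} (\<lambda>_. lborel))"
      by (rule PL.product_nn_integral_prod[symmetric]) auto
    also have "\<dots> \<le> ?V k"
      unfolding moment
    proof (rule nn_integral_mono)
      fix x :: "nat \<Rightarrow> real ^ 'n"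
      have "measure ?\<Theta> (\<Union>i<k. separating (x i)) \<le> (\<Sum>i<k. measure ?\<Theta> (separating (x i)))"
        by (rule measure_subadditive_finite) (auto simp: \<Theta>)
      then have "exp (- (\<Sum>i<k. a * norm (x i) powr r)) \<le> exp (- measure ?\<Theta> (\<Union>i<k. separating (x i)))"
        by (simp add: \<Theta>')
      moreover have "(\<Prod>i<k. ennreal (exp (- (a * norm (x i) powr r)))) = ennreal (exp (- (\<Sum>i<k. a * norm (x i) powr r)))"
        by (simp add: prod_ennreal exp_sum flip: sum_negf)
      ultimately show "(\<Prod>i<k. ennreal (exp (- (a * norm (x i) powr r))))
          \<le> ennreal (exp (- measure ?\<Theta> (\<Union>i<k. separating (x i))))"
        by (simp add: ennreal_leI)
    qed
    finally show ?thesis .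
  qed
  have upper: "?V k \<le> ennreal (Gamma (real k * n / r + 1) * \<kappa> ^ k * b powr (real k * n / r))" for k
  proof -
    have "?V k \<le> (\<integral>\<^sup>+x. \<integral>\<^sup>+s. ennreal (exp (- s)) * indicator {0..} s *
            (\<Prod>i<k. (if a * norm (x i :: real ^ 'n) powr r \<le> s then 1 else 0)) \<partial>lborel \<partial>Pi\<^sub>M {..<k} (\<lambda>_. lborel))"
      unfolding moment
    proof (rule nn_integral_mono)
      fix x :: "nat \<Rightarrow> real ^ 'n"
      let ?B = "\<Union>i<k. separating (x i)"
      have "emeasure ?\<Theta> ?B \<le> (\<Sum>i<k. emeasure ?\<Theta> (separating (x i)))"
        by (rule emeasure_subadditive_finite) auto
      also have "\<dots> < \<infinity>" by (simp add: \<Theta>)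
      finally have fin: "emeasure ?\<Theta> ?B < \<infinity>" .
      have "?B \<in> sets ?\<Theta>" by (intro sets.finite_UN) auto
      then have "a * norm (x i) powr r \<le> measure ?\<Theta> ?B" if "i < k" for i
        unfolding \<Theta>'[symmetric]
        by (intro measure_mono_fmeasurable) (use that fin in \<open>auto simp: fmeasurable_def\<close>)
      \<comment> \<open>Beyond the measure of \<open>?B\<close> every factor is 1, so the integrand
        dominates the exponential tail that starts there. The maximum itself is never named, and
        \<open>k = 0\<close> is included.\<close>
      then have "(\<Prod>i<k. (if a * norm (x i) powr r \<le> s then 1 else 0) :: ennreal) = 1" if "measure ?\<Theta> ?B \<le> s" for s
        using that by (intro prod.neutral) force
      moreover have "0 \<le> s" if "measure ?\<Theta> ?B \<le> s" for s
        using that measure_nonneg order_trans by blast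
      ultimately have "ennreal (exp (- s)) * indicator {measure ?\<Theta> ?B..} s
          \<le> ennreal (exp (- s)) * indicator {0..} s * (\<Prod>i<k. (if a * norm (x i) powr r \<le> s then 1 else 0))" for s
        by (cases "measure ?\<Theta> ?B \<le> s") simp_all
      then have "(\<integral>\<^sup>+s\<in>{measure ?\<Theta> ?B..}. ennreal (exp (- s)) \<partial>lborel)
          \<le> (\<integral>\<^sup>+s. ennreal (exp (- s)) * indicator {0..} s * (\<Prod>i<k. (if a * norm (x i) powr r \<le> s then 1 else 0)) \<partial>lborel)"
        by (rule nn_integral_mono)
      then show "ennreal (exp (- measure ?\<Theta> ?B))
          \<le> (\<integral>\<^sup>+s. ennreal (exp (- s)) * indicator {0..} s * (\<Prod>i<k. (if a * norm (x i) powr r \<le> s then 1 else 0)) \<partial>lborel)"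
        by (simp only: nn_integral_exp_minus_atLeast)
    qed
    also have "\<dots> = ennreal (Gamma (real k * n / r + 1) * \<kappa> ^ k * b powr (real k * n / r))"
      unfolding nn_integral_PiM_exp_minus[OF a r] DIM b \<kappa>_def ..
    finally show ?thesis .
  qed
  \<comment> \<open>For \<open>k = 1\<close> the two Gamma factors are the same number.\<close>
  have "?V 1 = ennreal (Gamma (n / r + 1) * \<kappa> * b powr (n / r))"
    using lower[of 1] upper[of 1] by (intro antisym) simp_all
  then show ?thesis
    using lower upper unfolding b_def by simp
qed

end
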